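(* Under the setting and standing assumptions described in the context, let $\{\tilde z_i\}$ with $\tilde z_i=z_{iN}$ be the sequence generated by the algorithm AManPG, and let $z_*$ be any accumulation point of $\{\tilde z_i\}$. Then $0\in P_{\mathrm{T}_{z_*}\mathcal{M}}\,\partial F(z_* )$, where $\partial F(z_* )$ is the Clarke generalized subdifferential of $F$ (as a function on $\mathbb{R}^{n\times p}$) at $z_*$.
   Context: Setting. $\mathcal{M}\subset\mathbb{R}^{n\times p}$ is a compact embedded Riemannian submanifold with the Frobenius inner product $\langle A,B\rangle=\mathrm{trace}(A^TB)$; $\mathrm{T}_x\mathcal{M}$ is its tangent space at $x$ and $P_{\mathrm{T}_x\mathcal{M}}$ the orthogonal projection onto it. $R$ is a smooth retraction defined on the whole tangent bundle: $R_x:\mathrm{T}_x\mathcal{M}\to\mathcal{M}$, $R_x(0)=x$, $\frac{d}{dt}R_x(t\xi)|_{t=0}=\xi$. $F=f+g$ where $f:\mathbb{R}^{n\times p}\to\mathbb{R}$ is continuously differentiable with $\nabla f$ Lipschitz with constant $L$, $g:\mathbb{R}^{n\times p}\to\mathbb{R}$ is continuous and convex, and $F$ is coercive ($F(x)\to\infty$ as $\|x\|_{\mathrm F}\to\infty$). The Riemannian gradient is $\mathrm{grad} f(x)=P_{\mathrm{T}_x\mathcal{M}}\nabla f(x)$. Weights. For each $x\in\mathcal{M}$, $W_x$ is a self-adjoint positive definite linear operator on $\mathrm{T}_x\mathcal{M}$ whose eigenvalues all lie in $[\kappa,\tilde\kappa]$ for fixed constants $0<\kappa\le\tilde\kappa$;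 $\|\eta\|_{W_x}^2=\langle\eta,W_x\eta\rangle$. Proximal direction. For $\mu>0$ and $x\in\mathcal{M}$, $\eta_x=\arg\min_{\eta\in\mathrm{T}_x\mathcal{M}}\langle\mathrm{grad} f(x),\eta\rangle+\frac{1}{2\mu}\|\eta\|_{W_x}^2+g(x+\eta)$ (unique minimizer). Algorithm AManPG. Parameters: $\mu\in(0,1/L]$, $\sigma\in(0,1)$ with $\sigma<\kappa/\mu$, $\nu\in(0,1)$, positive integer $N$. Initialize $x_0\in\mathcal{M}$, $t_0=1$, $y_0=z_0=x_0$. For $k=0,1,2,\dots$: (a) If $k$ is a multiple of $N$ (safeguard): compute $\eta_{z_k}$; let $\alpha$ be the first element of $1,\nu,\nu^2,\dots$ such that $F(R_{z_k}(\alpha\eta_{z_k}))\le F(z_k)-\sigma\alpha\|\eta_{z_k}\|_{\mathrm F}^2$; set $w=R_{z_k}(\alpha\eta_{z_k})$; if $F(w)<F(x_k)$, replace $x_k\leftarrow w$, $y_k\leftarrow w$, $t_k\leftarrow1$ (otherwise leave $x_k,y_k,t_k$ unchanged); then set $z_{k+N}=x_k$ (the possibly updated $x_k$). (b) Set $x_{k+1}=R_{y_k}(\eta_{y_k})$, $t_{k+1}=\frac{\sqrt{4t_k^2+1}+1}{2}$, and $y_{k+1}=R_{x_{k+1}}\big(\frac{1-t_k}{t_{k+1}}R_{x_{k+1}}^{-1}(x_k)\big)$, where it is assumed that the inverse retraction $R_{x_{k+1}}^{-1}(x_k)$ exists at every iteration. The sequence $\{z_k\}$ is defined only for $k$ multiple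 of $N$, and $\tilde z_i:=z_{iN}$. *)

theory Defs
  imports "HOL-Analysis.Analysis" "HOL-Library.Liminf_Limsup"
begin

text \<open>C-infinity smoothness on an open set of a Euclidean space: all iterated partial
  derivatives (along basis directions) exist and are continuous on S.\<close>
definition smooth_on :: "'a::euclidean_space set \<Rightarrow> ('a \<Rightarrow> 'b::real_normed_vector) \<Rightarrow> bool" where
  "smooth_on S f \<longleftrightarrow> open S \<and>
     (\<exists>\<F>. f \<in> \<F> \<and> (\<forall>h\<in>\<F>. continuous_on S h \<and>
        (\<forall>i\<in>Basis. \<exists>h'\<in>\<F>. \<forall>x\<in>S. ((\<lambda>s. h (x + s *\<^sub>R i)) has_vector_derivative h' x) (at 0))))"

definition smooth_map_on :: "'a::euclidean_space set \<Rightarrow> ('a \<Rightarrow> 'b::real_normed_vector) \<Rightarrow> bool" where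
  "smooth_map_on A f \<longleftrightarrow>
     (\<forall>x\<in>A. \<exists>U h. open U \<and> x \<in> U \<and> smooth_on U h \<and> (\<forall>y\<in>U \<inter> A. h y = f y))"

definition embedded_submanifold :: "'a::euclidean_space set \<Rightarrow> bool" where
  "embedded_submanifold M \<longleftrightarrow> (\<exists>d. \<forall>x\<in>M. \<exists>U V \<phi> \<psi> L.
     open U \<and> x \<in> U \<and> open V \<and> subspace L \<and> dim L = d \<and>
     smooth_on U (\<phi> :: 'a \<Rightarrow> 'a) \<and> smooth_on V (\<psi> :: 'a \<Rightarrow> 'a) \<and> \<phi> ` U = V \<and>
     (\<forall>y\<in>U. \<psi> (\<phi> y) = y) \<and> (\<forall>w\<in>V. \<phi> (\<psi> w) = w) \<and>
     \<phi> ` (M \<inter> U) = V \<inter> L)"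

definition tangent_space :: "'a::euclidean_space set \<Rightarrow> 'a \<Rightarrow> 'a set" where
  "tangent_space M x = {v. \<exists>\<gamma> \<epsilon>. \<epsilon> > 0 \<and> smooth_on {-\<epsilon><..<\<epsilon>} (\<gamma> :: real \<Rightarrow> 'a) \<and>
       (\<forall>s\<in>{-\<epsilon><..<\<epsilon>}. \<gamma> s \<in> M) \<and> \<gamma> 0 = x \<and> (\<gamma> has_vector_derivative v) (at 0)}"

definition proj_onto :: "'a::real_inner set \<Rightarrow> 'a \<Rightarrow> 'a" where
  "proj_onto S v = (THE w. w \<in> S \<and> (\<forall>u\<in>S. inner (v - w) u = 0))"

text \<open>Riemannian gradient, nf being the Euclidean gradient of f.\<close>
definition rgrad :: "'a::euclidean_space set \<Rightarrow> ('a \<Rightarrow> 'a) \<Rightarrow> 'a \<Rightarrow> 'a" where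
  "rgrad M nf x = proj_onto (tangent_space M x) (nf x)"

definition prox_dir :: "'a::euclidean_space set \<Rightarrow> ('a \<Rightarrow> 'a) \<Rightarrow> ('a \<Rightarrow> real) \<Rightarrow>
    ('a \<Rightarrow> 'a \<Rightarrow> 'a) \<Rightarrow> real \<Rightarrow> 'a \<Rightarrow> 'a" where
  "prox_dir M nf g W \<mu> x = (THE \<eta>. \<eta> \<in> tangent_space M x \<and>
     (\<forall>\<xi>\<in>tangent_space M x.
        inner (rgrad M nf x) \<eta> + inner \<eta> (W x \<eta>) / (2 * \<mu>) + g (x + \<eta>)
        \<le> inner (rgrad M nf x) \<xi> + inner \<xi> (W x \<xi>) / (2 * \<mu>) + g (x + \<xi>)))"

definition armijo_alpha :: "('a::real_normed_vector \<Rightarrow> real) \<Rightarrow> ('a \<Rightarrow> 'a \<Rightarrow> 'a) \<Rightarrow> real \<Rightarrow> real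
    \<Rightarrow> 'a \<Rightarrow> 'a \<Rightarrow> real" where
  "armijo_alpha F R \<sigma> \<nu> z \<eta> =
     \<nu> ^ (LEAST j. F (R z (\<nu> ^ j *\<^sub>R \<eta>)) \<le> F z - \<sigma> * \<nu> ^ j * (norm \<eta>)\<^sup>2)"

definition clarke_dd :: "('a::real_normed_vector \<Rightarrow> real) \<Rightarrow> 'a \<Rightarrow> 'a \<Rightarrow> ereal" where
  "clarke_dd F x v = Limsup (at (x, 0) within (UNIV \<times> {0<..}))
     (\<lambda>(y, s). ereal ((F (y + s *\<^sub>R v) - F y) / s))"

definition clarke_subdiff :: "('a::real_inner \<Rightarrow> real) \<Rightarrow> 'a \<Rightarrow> 'a set" where
  "clarke_subdiff F x = {\<xi>. \<forall>v. ereal (inner \<xi> v) \<le> clarke_dd F x v}"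

end

(*
Strict differentiability of the retraction at (x, 0), together with R_u(0) = u and DR_u(0) = id,
gives R_u(xi) = u + xi + o(|xi|) uniformly for u in M near x.  Strong convexity of the proximal
subproblem yields <grad f(u), eta_u> + g(u + eta_u) - g(u) <= -(kappa/mu) |eta_u|^2, and
sigma < kappa/mu then makes the Armijo condition hold for all step sizes below a threshold that is
uniform over the u near x with |eta_u| >= c.  The safeguard forces F to decrease along the z_{iN},
so alpha_i |eta_i|^2 -> 0, hence eta -> 0 along any convergent subsequence.  W need not be
continuous: only the bounds kappa and kappa' pass to the limit, where comparing eta with tangent
vectors xi_i -> xi and rescaling xi leaves the first-order inequality
g(z) <= <nabla f(z), xi> + g(z + xi) on the tangent space.  A separating hyperplane turns it into a
subgradient v of g with nabla f(z) + v normal to M, and nabla f(z) + v is a Clarke subgradient of F.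
*)
theory Submission
  imports Defs
begin

subsection \<open>Smooth maps are strictly differentiable\<close>

text \<open>The delicate point is the retraction. Only an extension of \<open>R\<close> to an open
  set has a derivative, and DR_u(0) = id is known solely on the tangent space at u, whereas the
  estimate centred at (x, 0) is applied to tangent vectors at points u other than x. An ordinary
  derivative at (x, 0) says nothing about increments based elsewhere; a strict one does, and it
  follows from continuity of the partial derivatives. The direction eta_u is not known to depend
  continuously on u. So eta -> 0 is not read off a limiting subproblem but forced by the line
  search: directions bounded away from 0 near z would keep the step lengths bounded below. The
  constant kappa/mu comes from testing the subproblem against s eta with s -> 1; testing against 0
  yields only half of it. Acceleration enters through the safeguard alone: whichever point is kept,
  its value of F is at most that of the Armijo point, so all that is asked of the accelerated
  iterates is that they stay in M.\<close>

lemma smooth_on_partials: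
  assumes "smooth_on S f"
  obtains p where "\<And>i. i \<in> Basis \<Longrightarrow> smooth_on S (p i)"
    and "\<And>i x. i \<in> Basis \<Longrightarrow> x \<in> S \<Longrightarrow> ((\<lambda>s. f (x + s *\<^sub>R i)) has_vector_derivative p i x) (at 0)"
proof -
  obtain \<F> where S: "open S" and f: "f \<in> \<F>" and
    F: "\<forall>h\<in>\<F>. continuous_on S h \<and>
        (\<forall>i\<in>Basis. \<exists>h'\<in>\<F>. \<forall>x\<in>S. ((\<lambda>s. h (x + s *\<^sub>R i)) has_vector_derivative h' x) (at 0))"
    using assms unfolding smooth_on_def by blast
  \<comment> \<open>The family that witnesses smoothness of \<open>f\<close> witnesses it for each
    of its members, so the partial derivatives are again smooth.\<close>
  have sm: "smooth_on S h" if "h \<in> \<F>" for h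
    using S F that unfolding smooth_on_def by blast
  obtain p where "\<And>i. i \<in> Basis \<Longrightarrow> p i \<in> \<F> \<and>
      (\<forall>x\<in>S. ((\<lambda>s. f (x + s *\<^sub>R i)) has_vector_derivative p i x) (at 0))"
    using F f by metis
  then show ?thesis using that[of p] sm by blast
qed

lemma smooth_on_continuous: "smooth_on S f \<Longrightarrow> continuous_on S f"
  unfolding smooth_on_def by blast

lemma smooth_on_open: "smooth_on S f \<Longrightarrow> open S"
  unfolding smooth_on_def by blast

lemma smooth_on_const: "open S \<Longrightarrow> smooth_on S (\<lambda>x. c)"
  unfolding smooth_on_def
  by (intro conjI exI[of _ "{\<lambda>x. c, \<lambda>x. 0}"]) (auto intro!: derivative_eq_intros)

lemma smooth_on_add:
  assumes "smooth_on S f" "smooth_on S g"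
  shows "smooth_on S (\<lambda>x. f x + g x)"
proof -
  obtain \<F> where f: "f \<in> \<F>" and
    F: "\<forall>h\<in>\<F>. continuous_on S h \<and>
        (\<forall>i\<in>Basis. \<exists>h'\<in>\<F>. \<forall>x\<in>S. ((\<lambda>s. h (x + s *\<^sub>R i)) has_vector_derivative h' x) (at 0))"
    using assms(1) unfolding smooth_on_def by blast
  obtain \<G> where g: "g \<in> \<G>" and
    G: "\<forall>h\<in>\<G>. continuous_on S h \<and>
        (\<forall>i\<in>Basis. \<exists>h'\<in>\<G>. \<forall>x\<in>S. ((\<lambda>s. h (x + s *\<^sub>R i)) has_vector_derivative h' x) (at 0))"
    using assms(2) unfolding smooth_on_def by blast
  let ?H = "{\<lambda>x. h x + k x | h k. h \<in> \<F> \<and> k \<in> \<G>}"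
  have 1: "continuous_on S l" if "l \<in> ?H" for l
    using that F G by (auto intro!: continuous_intros)
  have 2: "\<exists>l'\<in>?H. \<forall>x\<in>S. ((\<lambda>s. l (x + s *\<^sub>R i)) has_vector_derivative l' x) (at 0)"
    if l: "l \<in> ?H" and i: "i \<in> Basis" for l i
  proof -
    obtain h k where hk: "h \<in> \<F>" "k \<in> \<G>" "l = (\<lambda>x. h x + k x)" using l by blast
    obtain h' where h': "h' \<in> \<F>" "\<forall>x\<in>S. ((\<lambda>s. h (x + s *\<^sub>R i)) has_vector_derivative h' x) (at 0)"
      using F hk i by blast
    obtain k' where k': "k' \<in> \<G>" "\<forall>x\<in>S. ((\<lambda>s. k (x + s *\<^sub>R i)) has_vector_derivative k' x) (at 0)"
      using G hk i by blast
    show ?thesis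
      by (rule bexI[of _ "\<lambda>x. h' x + k' x"])
        (use h' k' hk in \<open>auto intro: has_vector_derivative_add\<close>)
  qed
  have "(\<lambda>x. f x + g x) \<in> ?H" using f g by blast
  then show ?thesis
    unfolding smooth_on_def[of S "\<lambda>x. f x + g x"] using 1 2 smooth_on_open[OF assms(1)]
    by (intro conjI exI[of _ ?H] ballI)
qed

lemma smooth_on_scaleR:
  assumes "smooth_on S f"
  shows "smooth_on S (\<lambda>x. c *\<^sub>R f x)"
proof -
  obtain \<F> where f: "f \<in> \<F>" and
    F: "\<forall>h\<in>\<F>. continuous_on S h \<and>
        (\<forall>i\<in>Basis. \<exists>h'\<in>\<F>. \<forall>x\<in>S. ((\<lambda>s. h (x + s *\<^sub>R i)) has_vector_derivative h' x) (at 0))"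
    using assms unfolding smooth_on_def by blast
  let ?H = "(\<lambda>h x. c *\<^sub>R h x) ` \<F>"
  have 1: "continuous_on S l" if "l \<in> ?H" for l
    using that F by (auto intro!: continuous_intros)
  have 2: "\<exists>l'\<in>?H. \<forall>x\<in>S. ((\<lambda>s. l (x + s *\<^sub>R i)) has_vector_derivative l' x) (at 0)"
    if l: "l \<in> ?H" and i: "i \<in> Basis" for l i
  proof -
    obtain h where h: "h \<in> \<F>" "l = (\<lambda>x. c *\<^sub>R h x)" using l by blast
    obtain h' where h': "h' \<in> \<F>" "\<forall>x\<in>S. ((\<lambda>s. h (x + s *\<^sub>R i)) has_vector_derivative h' x) (at 0)"
      using F h i by blast
    show ?thesis
      by (rule bexI[of _ "\<lambda>x. c *\<^sub>R h' x"])
        (use h h' in \<open>auto intro: bounded_linear.has_vector_derivative[OF bounded_linear_scaleR_right]\<close>)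
  qed
  have "(\<lambda>x. c *\<^sub>R f x) \<in> ?H" using f by blast
  then show ?thesis
    unfolding smooth_on_def[of S "\<lambda>x. c *\<^sub>R f x"] using 1 2 smooth_on_open[OF assms(1)]
    by (intro conjI exI[of _ ?H] ballI)
qed

lemma smooth_on_sum:
  assumes "finite I" "open S" "\<And>i. i \<in> I \<Longrightarrow> smooth_on S (f i)"
  shows "smooth_on S (\<lambda>x. \<Sum>i\<in>I. f i x)"
  using assms by (induction I rule: finite_induct) (auto intro: smooth_on_const smooth_on_add)

text \<open>The coordinates in \<open>B\<close> are changed one at a time, and each change is
  estimated by the mean value inequality, the continuous partial derivative staying within
  \<open>e\<close> of its value at \<open>x\<close>. The base point \<open>y\<close> is arbitrary
  near \<open>x\<close>, which is what makes the derivative strict.\<close>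

lemma strict_derivative_from_partials:
  fixes f :: "'a::euclidean_space \<Rightarrow> 'b::real_normed_vector"
  assumes S: "open S" "x \<in> S" and B: "finite B" "B \<subseteq> Basis" and e: "e > 0"
    and cont: "\<And>i. i \<in> Basis \<Longrightarrow> continuous_on S (p i)"
    and der: "\<And>i x. i \<in> Basis \<Longrightarrow> x \<in> S \<Longrightarrow> ((\<lambda>s. f (x + s *\<^sub>R i)) has_vector_derivative p i x) (at 0)"
  shows "\<exists>d>0. \<forall>y c. norm (y - x) < d \<longrightarrow> (\<forall>b\<in>B. \<bar>c b\<bar> < d) \<longrightarrow>
    norm (f (y + (\<Sum>b\<in>B. c b *\<^sub>R b)) - f y - (\<Sum>b\<in>B. c b *\<^sub>R p b x)) \<le> e * (\<Sum>b\<in>B. \<bar>c b\<bar>)"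
  using B
proof (induction B rule: finite_induct)
  case empty
  then show ?case by (auto intro: exI[of _ 1])
next
  case (insert b B)
  then obtain d where d: "d > 0" and IH: "\<And>y c. norm (y - x) < d \<Longrightarrow> (\<And>b. b\<in>B \<Longrightarrow> \<bar>c b\<bar> < d) \<Longrightarrow>
    norm (f (y + (\<Sum>b\<in>B. c b *\<^sub>R b)) - f y - (\<Sum>b\<in>B. c b *\<^sub>R p b x)) \<le> e * (\<Sum>b\<in>B. \<bar>c b\<bar>)"
    by auto
  have b: "b \<in> Basis" using insert by auto
  obtain r0 where r0: "r0 > 0" "ball x r0 \<subseteq> S"
    using S openE by blast
  obtain r1 where r1: "r1 > 0" "\<And>w. w \<in> S \<Longrightarrow> dist w x < r1 \<Longrightarrow> dist (p b w) (p b x) < e"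
    using cont[OF b] S e unfolding continuous_on_iff by metis
  define r where "r = min r0 r1"
  have r: "r > 0" "\<And>w. norm (w - x) < r \<Longrightarrow> w \<in> S \<and> norm (p b w - p b x) \<le> e"
    using r0 r1 unfolding r_def by (auto simp: subset_iff dist_norm norm_minus_commute less_imp_le)
  \<comment> \<open>Three contributions must fit into the radius \<open>r\<close>: the offset of
    \<open>y\<close>, the \<open>card B\<close> earlier coordinates and the last one, each at most
    \<open>d'\<close>; hence \<open>card B + 2\<close>.\<close>
  define d' where "d' = min d (r / (card B + 2))"
  have d': "d' > 0" "d' \<le> d" "(card B + 2) * d' \<le> r"
  proof -
    have "d' \<le> r / (card B + 2)" by (simp add: d'_def)
    then show "(card B + 2) * d' \<le> r" by (simp add: pos_le_divide_eq mult.commute)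
  qed (use d r in \<open>auto simp: d'_def\<close>)
  show ?case
  proof (intro exI[of _ d'] conjI allI impI)
    fix y c assume y: "norm (y - x) < d'" and c: "\<forall>b\<in>insert b B. \<bar>c b\<bar> < d'"
    define y' where "y' = y + (\<Sum>b\<in>B. c b *\<^sub>R b)"
    have "norm (\<Sum>b\<in>B. c b *\<^sub>R b) \<le> (\<Sum>b\<in>B. norm (c b *\<^sub>R b))" by (rule norm_sum)
    also have "\<dots> \<le> (\<Sum>b\<in>B. d')"
      using c insert.prems by (intro sum_mono) (auto simp: subset_iff less_imp_le)
    finally have nB: "norm (\<Sum>b\<in>B. c b *\<^sub>R b) \<le> card B * d'" by simp
    have near: "norm (y' + s *\<^sub>R b - x) < r" if "\<bar>s\<bar> \<le> \<bar>c b\<bar>" for s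
    proof -
      have "norm (y' + s *\<^sub>R b - x) \<le> norm (y - x) + norm (\<Sum>b\<in>B. c b *\<^sub>R b) + norm (s *\<^sub>R b)"
        using norm_triangle_ineq[of "y - x + (\<Sum>b\<in>B. c b *\<^sub>R b)" "s *\<^sub>R b"]
          norm_triangle_ineq[of "y - x" "\<Sum>b\<in>B. c b *\<^sub>R b"]
        unfolding y'_def by (simp add: algebra_simps)
      also have "norm (s *\<^sub>R b) \<le> d'" using that c b by auto
      finally show ?thesis using nB y d' by (simp add: algebra_simps)
    qed
    \<comment> \<open>Subtracting the linear part leaves a function of one variable whose derivative
      is the variation of \<open>p b\<close>, of norm at most \<open>e\<close>.\<close>
    let ?k = "\<lambda>s. f (y' + s *\<^sub>R b) - s *\<^sub>R p b x"
    let ?I = "{- \<bar>c b\<bar>..\<bar>c b\<bar>}"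
    have "norm (?k (c b) - ?k 0) \<le> e * norm (c b - 0)"
    proof (rule differentiable_bound[where S = ?I])
      show "(?k has_derivative (\<lambda>h. h *\<^sub>R (p b (y' + s *\<^sub>R b) - p b x))) (at s within ?I)"
        if "s \<in> ?I" for s
      proof -
        have "((\<lambda>u. f ((y' + s *\<^sub>R b) + u *\<^sub>R b)) has_vector_derivative p b (y' + s *\<^sub>R b)) (at 0)"
          by (rule der[OF b]) (use r near that in auto)
        then have "((\<lambda>u. f (y' + u *\<^sub>R b)) has_vector_derivative p b (y' + s *\<^sub>R b)) (at s)"
          using vector_diff_chain_at[of "\<lambda>u. u - s" 1 s "\<lambda>u. f ((y' + s *\<^sub>R b) + u *\<^sub>R b)"]
          by (simp add: o_def algebra_simps has_vector_derivative_diff_const)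
        then have "(?k has_vector_derivative (p b (y' + s *\<^sub>R b) - p b x)) (at s)"
          by (auto intro!: derivative_eq_intros)
        then show ?thesis
          by (auto simp: has_vector_derivative_def intro: has_derivative_at_withinI)
      qed
      show "onorm (\<lambda>h. h *\<^sub>R (p b (y' + s *\<^sub>R b) - p b x)) \<le> e" if "s \<in> ?I" for s
      proof (rule onorm_le)
        have "\<bar>s\<bar> \<le> \<bar>c b\<bar>" using that by auto
        then have "norm (p b (y' + s *\<^sub>R b) - p b x) \<le> e" using r(2)[OF near] by blast
        then show "norm (h *\<^sub>R (p b (y' + s *\<^sub>R b) - p b x)) \<le> e * norm h" for h
          using mult_left_mono[of _ e "\<bar>h\<bar>"] by (simp add: mult.commute[of e])
      qed
    qed auto
    then have 1: "norm (f (y' + c b *\<^sub>R b) - f y' - c b *\<^sub>R p b x) \<le> e * \<bar>c b\<bar>"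
      by (simp add: algebra_simps)
    have 2: "norm (f y' - f y - (\<Sum>b\<in>B. c b *\<^sub>R p b x)) \<le> e * (\<Sum>b\<in>B. \<bar>c b\<bar>)"
      unfolding y'_def by (rule IH) (use y c d' in auto)
    have eq: "y + (\<Sum>b\<in>insert b B. c b *\<^sub>R b) = y' + c b *\<^sub>R b"
      using insert by (simp add: y'_def algebra_simps)
    have "norm (f (y + (\<Sum>b\<in>insert b B. c b *\<^sub>R b)) - f y - (\<Sum>b\<in>insert b B. c b *\<^sub>R p b x))
       = norm ((f (y' + c b *\<^sub>R b) - f y' - c b *\<^sub>R p b x) + (f y' - f y - (\<Sum>b\<in>B. c b *\<^sub>R p b x)))"
      unfolding eq using insert by (simp add: algebra_simps)
    also have "\<dots> \<le> e * \<bar>c b\<bar> + e * (\<Sum>b\<in>B. \<bar>c b\<bar>)"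
      using norm_triangle_ineq 1 2 by (meson add_mono order_trans)
    also have "\<dots> = e * (\<Sum>b\<in>insert b B. \<bar>c b\<bar>)" using insert by (simp add: algebra_simps)
    finally show "norm (f (y + (\<Sum>b\<in>insert b B. c b *\<^sub>R b)) - f y - (\<Sum>b\<in>insert b B. c b *\<^sub>R p b x))
      \<le> e * (\<Sum>b\<in>insert b B. \<bar>c b\<bar>)" .
  qed (use d' in auto)
qed

text \<open>In contrast to the Frechet derivative, the base point \<open>y\<close> moves together
  with the increment; a single estimate at \<open>x\<close> then covers all nearby points.\<close>

definition has_strict_derivative ::
    "('a::real_normed_vector \<Rightarrow> 'b::real_normed_vector) \<Rightarrow> ('a \<Rightarrow> 'b) \<Rightarrow> 'a \<Rightarrow> bool" where
  "has_strict_derivative f D x \<longleftrightarrow> linear D \<and> (\<forall>e>0. \<exists>d>0. \<forall>y u. norm (y - x) < d \<longrightarrow> norm u < d \<longrightarrow>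
      norm (f (y + u) - f y - D u) \<le> e * norm u)"

text \<open>\<open>D x\<close> combines the partial derivatives with the coordinates of its
  argument. Its smooth dependence on \<open>x\<close> is kept in the conclusion because it later
  makes tangent frames continuous and lets derivatives be iterated along lines.\<close>

lemma smooth_on_strict_derivative:
  fixes f :: "'a::euclidean_space \<Rightarrow> 'b::real_normed_vector"
  assumes "smooth_on S f"
  obtains D where "\<And>u. smooth_on S (\<lambda>x. D x u)"
    and "\<And>x. x \<in> S \<Longrightarrow> has_strict_derivative f (D x) x"
proof -
  obtain p where p: "\<And>i. i \<in> Basis \<Longrightarrow> smooth_on S (p i)"
    "\<And>i x. i \<in> Basis \<Longrightarrow> x \<in> S \<Longrightarrow> ((\<lambda>s. f (x + s *\<^sub>R i)) has_vector_derivative p i x) (at 0)"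
    using smooth_on_partials[OF assms] by blast
  define D where "D = (\<lambda>x u. \<Sum>i\<in>Basis. (u \<bullet> i) *\<^sub>R p i x)"
  have S: "open S" using assms by (rule smooth_on_open)
  have lin: "linear (D x)" for x
    unfolding D_def by (rule linearI) (simp_all add: inner_add_left scaleR_left_distrib sum.distrib scaleR_sum_right)
  have strict: "\<exists>d>0. \<forall>y u. norm (y - x) < d \<longrightarrow> norm u < d \<longrightarrow>
      norm (f (y + u) - f y - D x u) \<le> e * norm u" if x: "x \<in> S" and e: "e > 0" for x and e :: real
  proof -
    let ?n = "real (card (Basis :: 'a set))"
    have n: "?n > 0" by simp
    have en: "e / ?n > 0" using e n by (rule divide_pos_pos)
    have "\<exists>d>0. \<forall>y c. norm (y - x) < d \<longrightarrow> (\<forall>b\<in>Basis. \<bar>c b\<bar> < d) \<longrightarrow>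
      norm (f (y + (\<Sum>b\<in>Basis. c b *\<^sub>R b)) - f y - (\<Sum>b\<in>Basis. c b *\<^sub>R p b x)) \<le> (e / ?n) * (\<Sum>b\<in>Basis. \<bar>c b\<bar>)"
      by (rule strict_derivative_from_partials[OF S x finite_Basis subset_refl en])
        (use p in \<open>auto intro: smooth_on_continuous\<close>)
    then obtain d where d: "d > 0" and D: "\<And>y c. norm (y - x) < d \<Longrightarrow> (\<forall>b\<in>Basis. \<bar>c b\<bar> < d) \<Longrightarrow>
      norm (f (y + (\<Sum>b\<in>Basis. c b *\<^sub>R b)) - f y - (\<Sum>b\<in>Basis. c b *\<^sub>R p b x)) \<le> (e / ?n) * (\<Sum>b\<in>Basis. \<bar>c b\<bar>)"
      by blast
    have "norm (f (y + u) - f y - D x u) \<le> e * norm u" if "norm (y - x) < d" "norm u < d" for y u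
    proof -
      have "norm (f (y + u) - f y - D x u) \<le> (e / ?n) * (\<Sum>b\<in>Basis. \<bar>u \<bullet> b\<bar>)"
        using D[of y "\<lambda>b. u \<bullet> b"] that le_less_trans[OF Basis_le_norm]
        by (auto simp: D_def euclidean_representation)
      also have "\<dots> \<le> (e / ?n) * (\<Sum>b\<in>(Basis::'a set). norm u)"
        using e by (intro mult_left_mono sum_mono Basis_le_norm) auto
      finally show ?thesis by simp
    qed
    then show ?thesis using d by blast
  qed
  show ?thesis
  proof (rule that[of D])
    show "smooth_on S (\<lambda>x. D x u)" for u
      unfolding D_def by (intro smooth_on_sum smooth_on_scaleR p S) auto
    show "has_strict_derivative f (D x) x" if "x \<in> S" for x
      unfolding has_strict_derivative_def using lin strict that by blast
  qed
qed

lemma has_strict_derivative_imp_has_derivative: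
  fixes f :: "'a::euclidean_space \<Rightarrow> 'b::real_normed_vector"
  assumes "has_strict_derivative f D x"
  shows "(f has_derivative D) (at x)"
  unfolding has_derivative_at_alt
proof (intro conjI allI impI)
  show "bounded_linear D" using assms by (simp add: linear_conv_bounded_linear has_strict_derivative_def)
  fix e :: real assume "e > 0"
  then obtain d where "d > 0" and d: "\<forall>y u. norm (y - x) < d \<longrightarrow> norm u < d \<longrightarrow>
      norm (f (y + u) - f y - D u) \<le> e * norm u"
    using assms unfolding has_strict_derivative_def by blast
  then show "\<exists>d>0. \<forall>y. norm (y - x) < d \<longrightarrow> norm (f y - f x - D (y - x)) \<le> e * norm (y - x)"

  proof (intro exI[of _ d] conjI allI impI)
    fix y assume "norm (y - x) < d"
    then show "norm (f y - f x - D (y - x)) \<le> e * norm (y - x)"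
      using d[rule_format, of x "y - x"] \<open>d > 0\<close> by simp
  qed (use \<open>d > 0\<close> in simp)
qed

text \<open>Needed because \<open>tangent_space\<close> asks for smooth curves, which are produced
  as images of segments in a chart. The restrictions to the line of all smooth functions form a
  witnessing family: differentiating one along the line gives the restriction of \<open>D\<close>
  applied to \<open>u\<close>, which is smooth again.\<close>

lemma smooth_on_affine_line:
  fixes f :: "'a::euclidean_space \<Rightarrow> 'b::real_normed_vector"
  assumes f: "smooth_on S f" and I: "open I" and sub: "\<And>s. s \<in> I \<Longrightarrow> w + s *\<^sub>R u \<in> S"
  shows "smooth_on I (\<lambda>s::real. f (w + s *\<^sub>R u))"
proof -
  let ?H = "{\<lambda>s. h (w + s *\<^sub>R u) | h :: 'a \<Rightarrow> 'b. smooth_on S h}"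
  have 1: "continuous_on I l" if "l \<in> ?H" for l
    using that sub
    by (auto intro!: continuous_on_compose2[OF smooth_on_continuous] continuous_intros)
  have 2: "\<exists>l'\<in>?H. \<forall>x\<in>I. ((\<lambda>s. l (x + s *\<^sub>R i)) has_vector_derivative l' x) (at 0)"
    if l: "l \<in> ?H" and i: "i \<in> Basis" for l i
  proof -
    obtain h where h: "smooth_on S h" "l = (\<lambda>s. h (w + s *\<^sub>R u))" using l by blast
    obtain D where D: "\<And>u. smooth_on S (\<lambda>x. D x u)" "\<And>x. x \<in> S \<Longrightarrow> has_strict_derivative h (D x) x"
      using smooth_on_strict_derivative[OF h(1)] by blast
    have i1: "i = 1" using i by simp
    have "((\<lambda>s. l (x + s *\<^sub>R i)) has_vector_derivative D (w + x *\<^sub>R u) u) (at 0)" if "x \<in> I" for x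
    proof -
      have "(h has_derivative D (w + x *\<^sub>R u)) (at (w + x *\<^sub>R u))"
        by (intro has_strict_derivative_imp_has_derivative D sub that)
      then have "(h has_derivative D (w + x *\<^sub>R u)) (at (w + (x + 0) *\<^sub>R u))" by simp
      moreover have "((\<lambda>s. w + (x + s) *\<^sub>R u) has_derivative (\<lambda>s. s *\<^sub>R u)) (at 0)"
        by (auto intro!: derivative_eq_intros)
      ultimately have "((\<lambda>s. h (w + (x + s) *\<^sub>R u)) has_derivative (\<lambda>s. D (w + x *\<^sub>R u) (s *\<^sub>R u))) (at 0)"
        by (rule has_derivative_compose[rotated])
      then show ?thesis
        using D(2)[OF sub[OF that]]
        by (simp add: has_vector_derivative_def has_strict_derivative_def i1 h linear_cmul)
    qed
    then show ?thesis using D(1) by (intro bexI[of _ "\<lambda>s. D (w + s *\<^sub>R u) u"]) auto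
  qed
  have "(\<lambda>s. f (w + s *\<^sub>R u)) \<in> ?H" using f by blast
  then show ?thesis
    unfolding smooth_on_def[of I] using 1 2 I by (intro conjI exI[of _ ?H] ballI)
qed

subsection \<open>Tangent spaces and retractions\<close>

lemma has_vector_derivative_imp_quotient_tendsto:
  assumes "(k has_vector_derivative v) (at (0::real))"
  shows "((\<lambda>s. (1 / s) *\<^sub>R (k s - k 0)) \<longlongrightarrow> v) (at 0)"
proof -
  have "((\<lambda>s. (k s - k 0 - s *\<^sub>R v) /\<^sub>R norm s) \<longlongrightarrow> 0) (at 0)"
    using assms by (simp add: has_vector_derivative_def has_derivative_at_within)
  then have "((\<lambda>s. norm ((k s - k 0 - s *\<^sub>R v) /\<^sub>R norm s)) \<longlongrightarrow> 0) (at 0)"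
    by (rule tendsto_norm_zero)
  then have "((\<lambda>s. norm ((1 / s) *\<^sub>R (k s - k 0) - v)) \<longlongrightarrow> 0) (at 0)"
  proof (rule Lim_transform_eventually)
    have "norm ((k s - k 0 - s *\<^sub>R v) /\<^sub>R norm s) = norm ((1 / s) *\<^sub>R (k s - k 0) - v)" if "s \<noteq> 0" for s
    proof -
      have "(1 / s) *\<^sub>R (k s - k 0) - v = (1 / s) *\<^sub>R (k s - k 0 - s *\<^sub>R v)"
        using that by (simp add: algebra_simps)
      then show ?thesis by (simp add: divide_inverse)
    qed
    then show "\<forall>\<^sub>F s in at 0. norm ((k s - k 0 - s *\<^sub>R v) /\<^sub>R norm s) = norm ((1 / s) *\<^sub>R (k s - k 0) - v)"
      by (auto simp: eventually_at_filter)
  qed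
  then show ?thesis by (simp add: tendsto_norm_zero_iff LIM_zero_iff)
qed

text \<open>A curve in \<open>M\<close> becomes under \<open>\<phi>\<close> a curve in
  \<open>L\<close>; its difference quotients lie in the closed subspace \<open>L\<close>, and so
  does their limit \<open>D\<phi> v\<close>, which \<open>D\<psi>\<close> sends back to
  \<open>v\<close>. Conversely, a vector \<open>u\<close> of \<open>L\<close> is realised by the
  image under \<open>\<psi>\<close> of the line through \<open>\<phi> x\<close> in direction
  \<open>u\<close>, which stays in \<open>M\<close> for short times.\<close>

lemma chart_tangent_space:
  fixes M :: "'a::euclidean_space set"
  assumes U: "open U" "x \<in> M \<inter> U" and V: "open V" and L: "subspace L" and \<psi>: "smooth_on V \<psi>"
    and imgs: "\<phi> ` U = V" "\<phi> ` (M \<inter> U) = V \<inter> L"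
    and inv: "\<And>y. y \<in> U \<Longrightarrow> \<psi> (\<phi> y) = y"
    and D\<phi>: "(\<phi> has_derivative D\<phi>) (at x)" and D\<psi>: "(\<psi> has_derivative D\<psi>) (at (\<phi> x))"
  shows "tangent_space M x = D\<psi> ` L"
proof (intro equalityI subsetI)
  fix v assume "v \<in> tangent_space M x"
  then obtain \<gamma> \<epsilon> where \<gamma>: "\<epsilon> > 0" "\<forall>s\<in>{-\<epsilon><..<\<epsilon>}. \<gamma> s \<in> M" "\<gamma> 0 = x"
    "(\<gamma> has_vector_derivative v) (at 0)" unfolding tangent_space_def by blast
  have "(\<gamma> has_derivative (\<lambda>s. s *\<^sub>R v)) (at 0)" using \<gamma>(4) by (simp add: has_vector_derivative_def)
  moreover have "(\<phi> has_derivative D\<phi>) (at (\<gamma> 0))" using D\<phi> \<gamma>(3) by simp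
  ultimately have "((\<lambda>s. \<phi> (\<gamma> s)) has_derivative (\<lambda>s. D\<phi> (s *\<^sub>R v))) (at 0)"
    by (rule has_derivative_compose)
  then have \<phi>\<gamma>: "((\<lambda>s. \<phi> (\<gamma> s)) has_vector_derivative D\<phi> v) (at 0)"
    using has_derivative_bounded_linear[OF D\<phi>]
    by (simp add: has_vector_derivative_def linear_simps)
  have tends: "((\<lambda>s. (1 / s) *\<^sub>R (\<phi> (\<gamma> s) - \<phi> x)) \<longlongrightarrow> D\<phi> v) (at 0)"
    using has_vector_derivative_imp_quotient_tendsto[OF \<phi>\<gamma>] \<gamma>(3) by simp
  have cont: "isCont \<gamma> 0" using \<gamma>(4) has_vector_derivative_continuous by blast
  have "eventually (\<lambda>s. \<gamma> s \<in> U) (at 0)"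
    using cont U \<gamma>(3) topological_tendstoD unfolding isCont_def by (metis IntD2)
  moreover have "eventually (\<lambda>s. s \<in> {-\<epsilon><..<\<epsilon>}) (at (0::real))"
    using \<gamma>(1) by (intro eventually_at_in_open') auto
  ultimately have "eventually (\<lambda>s. (1 / s) *\<^sub>R (\<phi> (\<gamma> s) - \<phi> x) \<in> L) (at 0)"
  proof eventually_elim
    case (elim s)
    then have "\<phi> (\<gamma> s) \<in> L" using \<gamma>(2) imgs(2) by blast
    moreover have "\<phi> x \<in> L" using U imgs(2) by blast
    ultimately show ?case using L by (intro subspace_scale subspace_diff)
  qed
  then have "D\<phi> v \<in> L"
    using Lim_in_closed_set[OF closed_subspace[OF L] _ _ tends] by simp
  moreover have "D\<psi> (D\<phi> v) = v"
  proof -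
    have "((\<lambda>y. \<psi> (\<phi> y)) has_derivative (\<lambda>h. D\<psi> (D\<phi> h))) (at x)"
      using has_derivative_compose[OF D\<phi> D\<psi>] .
    then have "((\<lambda>y. y) has_derivative (\<lambda>h. D\<psi> (D\<phi> h))) (at x)"
      using U inv by (auto intro: has_derivative_transform_within_open)
    then show ?thesis using has_derivative_unique[OF _ has_derivative_ident] by metis
  qed
  ultimately show "v \<in> D\<psi> ` L" by force
next
  fix v assume "v \<in> D\<psi> ` L"
  then obtain u where u: "u \<in> L" "v = D\<psi> u" by blast
  have px: "\<phi> x \<in> V" "\<phi> x \<in> L" using U imgs by blast+
  have "open ((\<lambda>s. \<phi> x + s *\<^sub>R u) -` V)"
    using V by (intro open_vimage continuous_intros)
  moreover have "(0::real) \<in> (\<lambda>s. \<phi> x + s *\<^sub>R u) -` V" using px by simp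
  ultimately obtain \<epsilon> :: real where \<epsilon>: "\<epsilon> > 0" "ball 0 \<epsilon> \<subseteq> (\<lambda>s. \<phi> x + s *\<^sub>R u) -` V"
    using openE by blast
  then have inV: "\<phi> x + s *\<^sub>R u \<in> V" if "s \<in> {-\<epsilon><..<\<epsilon>}" for s
    using that by (auto simp: subset_iff)
  let ?\<gamma> = "\<lambda>s. \<psi> (\<phi> x + s *\<^sub>R u)"
  have "smooth_on {-\<epsilon><..<\<epsilon>} ?\<gamma>"
    by (rule smooth_on_affine_line[OF \<psi> _ inV]) auto
  moreover have "?\<gamma> s \<in> M" if "s \<in> {-\<epsilon><..<\<epsilon>}" for s
  proof -
    have "\<phi> x + s *\<^sub>R u \<in> V \<inter> L"
      using inV[OF that] L px u by (auto intro: subspace_add subspace_scale)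
    then obtain m where "m \<in> M \<inter> U" "\<phi> x + s *\<^sub>R u = \<phi> m" using imgs(2) by blast
    then show ?thesis using inv by simp
  qed
  moreover have "?\<gamma> 0 = x" using inv U by simp
  moreover have "(?\<gamma> has_vector_derivative v) (at 0)"
  proof -
    have "((\<lambda>s. \<phi> x + s *\<^sub>R u) has_derivative (\<lambda>s. s *\<^sub>R u)) (at 0)"
      by (auto intro!: derivative_eq_intros)
    moreover have "(\<psi> has_derivative D\<psi>) (at (\<phi> x + 0 *\<^sub>R u))" using D\<psi> by simp
    ultimately have "(?\<gamma> has_derivative (\<lambda>s. D\<psi> (s *\<^sub>R u))) (at 0)"
      by (rule has_derivative_compose)
    then show ?thesis using has_derivative_bounded_linear[OF D\<psi>] u
      by (simp add: has_vector_derivative_def linear_simps)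
  qed
  ultimately show "v \<in> tangent_space M x"
    unfolding tangent_space_def using \<epsilon>(1) by blast
qed

text \<open>In a chart, one fixed subspace parametrises all tangent spaces near \<open>x\<close>.
  Both the subspace property and the approximation of tangent vectors at a limit point are read off
  from this form.\<close>

lemma tangent_space_frame:
  fixes M :: "'a::euclidean_space set"
  assumes M: "embedded_submanifold M" "x \<in> M"
  shows "\<exists>U (L :: 'a set) A. open U \<and> x \<in> U \<and> subspace L \<and>
    (\<forall>y \<in> M \<inter> U. linear (A y) \<and> tangent_space M y = A y ` L) \<and> (\<forall>u. continuous_on U (\<lambda>y. A y u))"
proof -
  obtain d where d: "\<forall>x\<in>M. \<exists>U V \<phi> \<psi> L.
     open U \<and> x \<in> U \<and> open V \<and> subspace L \<and> dim L = d \<and>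
     smooth_on U (\<phi> :: 'a \<Rightarrow> 'a) \<and> smooth_on V (\<psi> :: 'a \<Rightarrow> 'a) \<and> \<phi> ` U = V \<and>
     (\<forall>y\<in>U. \<psi> (\<phi> y) = y) \<and> (\<forall>w\<in>V. \<phi> (\<psi> w) = w) \<and>
     \<phi> ` (M \<inter> U) = V \<inter> L"
    using M(1) unfolding embedded_submanifold_def by (rule exE)
  obtain U V \<phi> \<psi> L where chart: "open U \<and> x \<in> U \<and> open V \<and> subspace L \<and> dim L = d \<and>
     smooth_on U (\<phi> :: 'a \<Rightarrow> 'a) \<and> smooth_on V (\<psi> :: 'a \<Rightarrow> 'a) \<and> \<phi> ` U = V \<and>
     (\<forall>y\<in>U. \<psi> (\<phi> y) = y) \<and> (\<forall>w\<in>V. \<phi> (\<psi> w) = w) \<and>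
     \<phi> ` (M \<inter> U) = V \<inter> L"
    using bspec[OF d M(2)] by (elim exE) (rule that)
  then have UV: "open U" "x \<in> U" "open V" "subspace L"
    and sm: "smooth_on U \<phi>" "smooth_on V \<psi>"
    and img: "\<phi> ` U = V" "\<phi> ` (M \<inter> U) = V \<inter> L" and inv: "\<And>y. y \<in> U \<Longrightarrow> \<psi> (\<phi> y) = y"
    by simp_all
  obtain D\<phi> where D\<phi>: "\<And>x. x \<in> U \<Longrightarrow> has_strict_derivative \<phi> (D\<phi> x) x"
    using smooth_on_strict_derivative[OF sm(1)] by blast
  obtain D\<psi> where D\<psi>: "\<And>u. smooth_on V (\<lambda>x. D\<psi> x u)" "\<And>x. x \<in> V \<Longrightarrow> has_strict_derivative \<psi> (D\<psi> x) x"
    using smooth_on_strict_derivative[OF sm(2)] by blast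
  show ?thesis
  proof (rule exI[of _ U], rule exI[of _ L], rule exI[of _ "\<lambda>y. D\<psi> (\<phi> y)"], intro conjI ballI allI)
    show "tangent_space M y = D\<psi> (\<phi> y) ` L" if y: "y \<in> M \<inter> U" for y
    proof (rule chart_tangent_space[OF UV(1) y UV(3,4) sm(2) img inv])
      show "(\<phi> has_derivative D\<phi> y) (at y)"
        using y by (intro has_strict_derivative_imp_has_derivative D\<phi>) auto
      show "(\<psi> has_derivative D\<psi> (\<phi> y)) (at (\<phi> y))"
        using y img by (intro has_strict_derivative_imp_has_derivative D\<psi>) auto
    qed
    show "continuous_on U (\<lambda>y. D\<psi> (\<phi> y) u)" for u
      using img by (intro continuous_on_compose2[OF smooth_on_continuous[OF D\<psi>(1)]]
          smooth_on_continuous sm) auto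
    show "linear (D\<psi> (\<phi> y))" if "y \<in> M \<inter> U" for y
      using D\<psi>(2)[of "\<phi> y"] that img by (auto simp: has_strict_derivative_def)
  qed (use UV in auto)
qed

lemma subspace_tangent_space:
  fixes M :: "'a::euclidean_space set"
  assumes "embedded_submanifold M" "x \<in> M"
  shows "subspace (tangent_space M x)"
proof -
  obtain U and L :: "'a set" and A where "x \<in> U" "subspace L"
    "\<forall>y \<in> M \<inter> U. linear (A y) \<and> tangent_space M y = A y ` L"
    using tangent_space_frame[OF assms] by blast
  then show ?thesis using assms by (simp add: linear_subspace_image)
qed

text \<open>The coordinates \<open>u\<close> of the limit vector in the frame are kept fixed and
  transported to the points \<open>X n\<close>.\<close>

lemma tangent_space_lower_semicontinuous:
  fixes M :: "'a::euclidean_space set"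
  assumes M: "embedded_submanifold M" and X: "\<And>n. X n \<in> M" "X \<longlonglongrightarrow> x" "x \<in> M"
    and \<xi>: "\<xi> \<in> tangent_space M x"
  obtains \<Xi> where "\<And>n. \<Xi> n \<in> tangent_space M (X n)" "\<Xi> \<longlonglongrightarrow> \<xi>"
proof -
  obtain U and L :: "'a set" and A where U: "open U" "x \<in> U"
    and A: "\<forall>y \<in> M \<inter> U. linear (A y) \<and> tangent_space M y = A y ` L"
     "\<forall>u. continuous_on U (\<lambda>y. A y u)"
    using tangent_space_frame[OF M X(3)] by blast
  obtain u where u: "u \<in> L" "\<xi> = A x u" using A(1) X(3) U(2) \<xi> by blast
  \<comment> \<open>The value 0 serves the finitely many \<open>n\<close> for which
    \<open>X n\<close> is still outside the chart, where any tangent vector will do.\<close>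
  define \<Xi> where "\<Xi> = (\<lambda>n. if X n \<in> U then A (X n) u else 0)"
  have "\<Xi> n \<in> tangent_space M (X n)" for n
    using A(1) u X(1)[of n] subspace_0[OF subspace_tangent_space[OF M X(1)[of n]]]
    by (auto simp: \<Xi>_def)
  moreover have "\<Xi> \<longlonglongrightarrow> \<xi>"
  proof (rule Lim_transform_eventually)
    show "(\<lambda>n. A (X n) u) \<longlonglongrightarrow> \<xi>"
    proof -
      have "isCont (\<lambda>y. A y u) x" using A(2) U by (simp add: continuous_on_eq_continuous_at)
      then show ?thesis using isCont_tendsto_compose[OF _ X(2)] u by blast
    qed
    have "eventually (\<lambda>n. X n \<in> U) sequentially" by (rule topological_tendstoD[OF X(2) U(1,2)])
    then show "eventually (\<lambda>n. A (X n) u = \<Xi> n) sequentially"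
      by eventually_elim (simp add: \<Xi>_def)
  qed
  ultimately show ?thesis using that by blast
qed

text \<open>Half of \<open>e\<close> pays for strict differentiability of a local extension
  \<open>h\<close> at (x, 0), which compares \<open>R u \<xi> - u\<close> with
  \<open>D0 (0, \<xi>)\<close>. The other half pays for the distance of \<open>D0 (0, \<xi>)\<close>
  from \<open>\<xi>\<close>: the two need not agree when u differs from x, but the first estimate at
  \<open>s *\<^sub>R \<xi>\<close>, divided by s, bounds their distance as s tends to 0, since R_u
  has derivative id at 0.\<close>

lemma retraction_first_order:
  fixes M :: "'a::euclidean_space set" and R :: "'a \<Rightarrow> 'a \<Rightarrow> 'a"
  assumes M: "embedded_submanifold M"
    and R_smooth: "smooth_map_on {(u, \<xi>). u \<in> M \<and> \<xi> \<in> tangent_space M u} (\<lambda>(u, \<xi>). R u \<xi>)"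
    and R_zero: "\<And>u. u \<in> M \<Longrightarrow> R u 0 = u"
    and R_deriv: "\<And>u \<xi>. u \<in> M \<Longrightarrow> \<xi> \<in> tangent_space M u \<Longrightarrow>
                    ((\<lambda>s. R u (s *\<^sub>R \<xi>)) has_vector_derivative \<xi>) (at 0)"
    and x: "x \<in> M" and e: "e > 0"
  obtains d where "d > 0" "\<And>u \<xi>. u \<in> M \<Longrightarrow> norm (u - x) < d \<Longrightarrow> \<xi> \<in> tangent_space M u \<Longrightarrow>
    norm \<xi> < d \<Longrightarrow> norm (R u \<xi> - u - \<xi>) \<le> e * norm \<xi>"
proof -
  let ?TM = "{(u, \<xi>). u \<in> M \<and> \<xi> \<in> tangent_space M u}"
  note sub = subspace_tangent_space[OF M]
  have "(x, 0) \<in> ?TM" using x subspace_0[OF sub[OF x]] by simp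
  obtain U h where "open U \<and> (x, 0) \<in> U \<and> smooth_on U h \<and> (\<forall>y\<in>U \<inter> ?TM. h y = (\<lambda>(u, \<xi>). R u \<xi>) y)"
    using bspec[OF R_smooth[unfolded smooth_map_on_def] \<open>(x, 0) \<in> ?TM\<close>] by (elim exE) (rule that)
  then have U: "open U" "(x, 0) \<in> U" "smooth_on U h"
    and h: "\<forall>y\<in>U \<inter> ?TM. h y = (\<lambda>(u, \<xi>). R u \<xi>) y" by simp_all
  obtain D0 where "has_strict_derivative h D0 (x, 0)"
    using smooth_on_strict_derivative[OF U(3)] U(2) by blast
  then have D0: "linear D0" and "\<exists>d>0. \<forall>y u. norm (y - (x, 0)) < d \<longrightarrow> norm u < d \<longrightarrow>
        norm (h (y + u) - h y - D0 u) \<le> (e / 2) * norm u"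
    using e unfolding has_strict_derivative_def by (blast, meson half_gt_zero)
  then obtain d1 where d1: "d1 > 0" and hd: "\<And>y u. norm (y - (x, 0)) < d1 \<Longrightarrow> norm u < d1 \<Longrightarrow>
        norm (h (y + u) - h y - D0 u) \<le> (e / 2) * norm u"
    by blast
  obtain d2 where d2: "d2 > 0" "ball (x, 0) d2 \<subseteq> U" using U openE by blast
  define d where "d = min d1 (d2 / 2)"
  have d: "d > 0" "d \<le> d1" "2 * d \<le> d2" using d1 d2 by (auto simp: d_def)
  have hR: "h (u, \<xi>) = R u \<xi>" if "u \<in> M" "norm (u - x) < d" "\<xi> \<in> tangent_space M u" "norm \<xi> < d" for u \<xi>
  proof -
    have "norm (u - x, \<xi>) \<le> norm (u - x) + norm \<xi>" by (rule norm_Pair_le)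
    then have "(u, \<xi>) \<in> ball (x, 0) d2"
      using that d dist_norm[of "(u, \<xi>)" "(x, 0)"] by (simp add: dist_commute)
    then show ?thesis using h d2 that by auto
  qed
  have key: "norm (R u \<xi> - u - D0 (0, \<xi>)) \<le> (e / 2) * norm \<xi>"
    if "u \<in> M" "norm (u - x) < d" "\<xi> \<in> tangent_space M u" "norm \<xi> < d" for u \<xi>
  proof -
    have "norm (h ((u, 0) + (0, \<xi>)) - h (u, 0) - D0 (0, \<xi>)) \<le> (e / 2) * norm ((0, \<xi>) :: 'a \<times> 'a)"
      using that d by (intro hd) (auto simp: norm_Pair)
    then show ?thesis
      using hR[OF that] hR[of u 0] that subspace_0[OF sub[of u]] d(1) R_zero[of u]
      by (simp add: norm_Pair)
  qed
  show ?thesis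
  proof (rule that[of d])
    fix u \<xi> assume a: "u \<in> M" "norm (u - x) < d" "\<xi> \<in> tangent_space M u" "norm \<xi> < d"
    have "((\<lambda>s. (1 / s) *\<^sub>R (R u (s *\<^sub>R \<xi>) - u)) \<longlongrightarrow> \<xi>) (at 0)"
      using has_vector_derivative_imp_quotient_tendsto[OF R_deriv[OF a(1,3)]] R_zero[OF a(1)] by simp
    then have lim: "((\<lambda>s. norm ((1 / s) *\<^sub>R (R u (s *\<^sub>R \<xi>) - u) - D0 (0, \<xi>))) \<longlongrightarrow> norm (\<xi> - D0 (0, \<xi>))) (at_right 0)"
      by (intro tendsto_intros) (rule filterlim_at_split[THEN iffD1, THEN conjunct2])
    have "eventually (\<lambda>s::real. s \<in> {0<..<1}) (at_right 0)"
      by (rule eventually_at_right_real) simp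
    then have "eventually (\<lambda>s. norm ((1 / s) *\<^sub>R (R u (s *\<^sub>R \<xi>) - u) - D0 (0, \<xi>)) \<le> (e / 2) * norm \<xi>) (at_right 0)"
    proof eventually_elim
      case (elim s)
      have "norm (s *\<^sub>R \<xi>) < d"
        using elim a(4) mult_left_le_one_le[of "norm \<xi>" s] by auto
      then have "norm (R u (s *\<^sub>R \<xi>) - u - D0 (0, s *\<^sub>R \<xi>)) \<le> (e / 2) * norm (s *\<^sub>R \<xi>)"
        using a sub by (intro key subspace_scale) auto
      moreover have "D0 (0, s *\<^sub>R \<xi>) = s *\<^sub>R D0 (0, \<xi>)"
        using linear_cmul[OF D0, of s "(0, \<xi>)"] by simp
      ultimately have "norm (R u (s *\<^sub>R \<xi>) - u - s *\<^sub>R D0 (0, \<xi>)) \<le> s * ((e / 2) * norm \<xi>)"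
        using elim by (simp add: mult.left_commute)
      moreover have "R u (s *\<^sub>R \<xi>) - u - s *\<^sub>R D0 (0, \<xi>) = s *\<^sub>R ((1 / s) *\<^sub>R (R u (s *\<^sub>R \<xi>) - u) - D0 (0, \<xi>))"
        using elim by (simp add: algebra_simps)
      ultimately have "s * norm ((1 / s) *\<^sub>R (R u (s *\<^sub>R \<xi>) - u) - D0 (0, \<xi>)) \<le> s * ((e / 2) * norm \<xi>)"
        using elim by (metis abs_of_pos greaterThanLessThan_iff norm_scaleR)
      then show ?case using elim by (simp only: mult_le_cancel_left_pos greaterThanLessThan_iff)
    qed
    then have "norm (\<xi> - D0 (0, \<xi>)) \<le> (e / 2) * norm \<xi>"
      by (intro tendsto_upperbound[OF lim]) auto
    moreover have "norm (R u \<xi> - u - D0 (0, \<xi>)) \<le> (e / 2) * norm \<xi>" using key[OF a] .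
    moreover have "norm (R u \<xi> - u - \<xi>) \<le> norm (R u \<xi> - u - D0 (0, \<xi>)) + norm (\<xi> - D0 (0, \<xi>))"
      using norm_triangle_ineq4[of "R u \<xi> - u - D0 (0, \<xi>)" "\<xi> - D0 (0, \<xi>)"] by simp
    ultimately show "norm (R u \<xi> - u - \<xi>) \<le> e * norm \<xi>" by (simp add: field_simps)
  qed (rule d)
qed

subsection \<open>Quadratic forms, convex functions and the proximal subproblem\<close>

lemma proj_onto_eqI:
  fixes T :: "'a::euclidean_space set"
  assumes T: "subspace T" and w: "w \<in> T" "\<And>u. u \<in> T \<Longrightarrow> inner (v - w) u = 0"
  shows "proj_onto T v = w"
  unfolding proj_onto_def
proof (rule the_equality)
  fix w' assume w': "w' \<in> T \<and> (\<forall>u\<in>T. inner (v - w') u = 0)"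
  have d: "w - w' \<in> T" using T w w' by (simp add: subspace_diff)
  have "inner (v - w') (w - w') - inner (v - w) (w - w') = 0"
    using w(2)[OF d] w' d by simp
  then have "inner (w - w') (w - w') = 0" by (simp add: inner_diff_left)
  then show "w' = w" by simp
qed (use w in auto)

lemma
  fixes T :: "'a::euclidean_space set"
  assumes T: "subspace T"
  shows proj_onto_in: "proj_onto T v \<in> T"
    and inner_proj_onto: "u \<in> T \<Longrightarrow> inner (proj_onto T v) u = inner v u"
proof -
  obtain y z where yz: "y \<in> span T" "\<And>w. w \<in> span T \<Longrightarrow> orthogonal z w" "v = y + z"
    using orthogonal_subspace_decomp_exists[of T v] by blast
  have y: "y \<in> T" and z: "\<And>w. w \<in> T \<Longrightarrow> inner z w = 0"
    using yz T by (auto simp: span_eq_iff[THEN iffD2] orthogonal_def)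
  have "proj_onto T v = y"
    using y z yz(3) by (intro proj_onto_eqI[OF T]) auto
  then show "proj_onto T v \<in> T" "u \<in> T \<Longrightarrow> inner (proj_onto T v) u = inner v u"
    using y z yz(3) by (auto simp: inner_add_left)
qed

lemma proj_onto_self: "subspace T \<Longrightarrow> v \<in> T \<Longrightarrow> proj_onto T v = v"
  for T :: "'a::euclidean_space set"
  by (rule proj_onto_eqI) auto

lemma linear_proj_onto:
  fixes T :: "'a::euclidean_space set"
  assumes T: "subspace T"
  shows "linear (proj_onto T)"
proof (rule linearI)
  show "proj_onto T (v + w) = proj_onto T v + proj_onto T w" for v w
    by (intro proj_onto_eqI T subspace_add proj_onto_in)
      (simp add: inner_diff_left inner_add_left inner_proj_onto T)
  show "proj_onto T (c *\<^sub>R v) = c *\<^sub>R proj_onto T v" for c v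
    by (intro proj_onto_eqI T subspace_scale proj_onto_in)
      (simp add: inner_diff_left inner_proj_onto T)
qed

lemma linear_coeff_zero_if_quadratic_nonneg:
  fixes b c :: real
  assumes "\<And>s. 0 \<le> s * b + s\<^sup>2 * c"
  shows "b = 0"
proof (rule ccontr)
  assume "b \<noteq> 0"
  \<comment> \<open>\<open>k\<close> is positive and exceeds \<open>c\<close>, so at s = - b / k the
    linear term outweighs the quadratic one.\<close>
  define k where "k = \<bar>c\<bar> + 1"
  define s where "s = - b / k"
  have p: "k > 0" "c < k" by (auto simp: k_def)
  have "s * b + s\<^sup>2 * c = (b\<^sup>2 / k\<^sup>2) * (c - k)"
    using p unfolding s_def by (simp add: field_simps power2_eq_square)
  also have "\<dots> < 0"
    using \<open>b \<noteq> 0\<close> p by (intro mult_pos_neg divide_pos_pos) auto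
  finally show False using assms[of s] by simp
qed

text \<open>The Rayleigh quotient attains its minimum on the compact unit sphere of
  \<open>T\<close>, and a minimiser is an eigenvector.\<close>

lemma min_eigenvector_exists:
  fixes T :: "'a::euclidean_space set"
  assumes T: "subspace T" and ne: "T \<noteq> {0}" and A: "linear A" "\<And>\<xi>. \<xi> \<in> T \<Longrightarrow> A \<xi> \<in> T"
    and sym: "\<And>\<xi> \<xi>'. \<xi> \<in> T \<Longrightarrow> \<xi>' \<in> T \<Longrightarrow> inner (A \<xi>) \<xi>' = inner \<xi> (A \<xi>')"
  obtains m v where "v \<in> T" "v \<noteq> 0" "A v = m *\<^sub>R v" "\<And>\<xi>. \<xi> \<in> T \<Longrightarrow> m * (norm \<xi>)\<^sup>2 \<le> inner \<xi> (A \<xi>)"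
proof -
  let ?S = "T \<inter> sphere 0 1"
  obtain w where w: "w \<in> T" "w \<noteq> 0" using ne T subspace_0 by blast
  have "w /\<^sub>R norm w \<in> ?S" using w T by (simp add: subspace_scale)
  then have "?S \<noteq> {}" by blast
  moreover have "compact ?S" using T by (intro closed_Int_compact closed_subspace) auto
  moreover have "continuous_on ?S (\<lambda>\<xi>. inner \<xi> (A \<xi>))"
    by (intro continuous_intros linear_continuous_on) (simp add: A linear_conv_bounded_linear[symmetric])
  ultimately obtain v where v: "v \<in> ?S" "\<And>\<xi>. \<xi> \<in> ?S \<Longrightarrow> inner v (A v) \<le> inner \<xi> (A \<xi>)"
    using continuous_attains_inf by (metis (no_types, lifting))
  define m where "m = inner v (A v)"
  have vT: "v \<in> T" and vn: "norm v = 1" using v by auto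
  have bound: "m * (norm \<xi>)\<^sup>2 \<le> inner \<xi> (A \<xi>)" if \<xi>: "\<xi> \<in> T" for \<xi>
  proof (cases "\<xi> = 0")
    case False
    have "m \<le> inner (\<xi> /\<^sub>R norm \<xi>) (A (\<xi> /\<^sub>R norm \<xi>))"
      unfolding m_def using \<xi> T False by (intro v(2)) (simp add: subspace_scale)
    also have "\<dots> = inner \<xi> (A \<xi>) / (norm \<xi>)\<^sup>2"
      by (simp add: linear_cmul[OF A(1)] divide_inverse power2_eq_square)
    finally show ?thesis using False by (simp add: field_simps)
  qed simp
  define h where "h = A v - m *\<^sub>R v"
  have hT: "h \<in> T" unfolding h_def by (intro subspace_diff subspace_scale T A(2) vT)
  \<comment> \<open>With \<open>h\<close> the residual of the eigenvalue equation, the bound at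
    \<open>v + s *\<^sub>R h\<close> is a quadratic inequality in s without constant term; its
    linear coefficient 2 |h|^2 must vanish.\<close>
  have "0 \<le> s * (2 * inner h h) + s\<^sup>2 * (inner h (A h) - m * inner h h)" for s
  proof -
    have vh: "inner v (A h) = inner h (A v)" using sym[OF vT hT] by (simp add: inner_commute)
    have "m * inner (v + s *\<^sub>R h) (v + s *\<^sub>R h) \<le> inner (v + s *\<^sub>R h) (A (v + s *\<^sub>R h))"
      using bound[of "v + s *\<^sub>R h"] vT hT T
      by (simp add: subspace_add subspace_scale power2_norm_eq_inner)
    moreover have "inner (v + s *\<^sub>R h) (A (v + s *\<^sub>R h))
        = m + 2 * s * inner h (A v) + s\<^sup>2 * inner h (A h)"
      by (simp add: linear_add[OF A(1)] linear_cmul[OF A(1)] inner_add_left inner_add_right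
          vh m_def power2_eq_square algebra_simps)
    moreover have "inner (v + s *\<^sub>R h) (v + s *\<^sub>R h) = 1 + 2 * s * inner h v + s\<^sup>2 * inner h h"
      using vn by (simp add: inner_add_left inner_add_right norm_eq_1 inner_commute
          power2_eq_square algebra_simps)
    moreover have "inner h (A v) = inner h h + m * inner h v"
      unfolding h_def by (simp add: inner_diff_right inner_diff_left algebra_simps)
    ultimately have "m * (1 + 2 * s * inner h v + s\<^sup>2 * inner h h)
        \<le> m + 2 * s * (inner h h + m * inner h v) + s\<^sup>2 * inner h (A h)"
      by (simp only:)
    then show ?thesis by (simp add: algebra_simps)
  qed
  from linear_coeff_zero_if_quadratic_nonneg[OF this] have "h = 0" by simp
  then have "A v = m *\<^sub>R v" by (simp add: h_def)
  moreover have "v \<noteq> 0" using vn by auto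
  ultimately show ?thesis using that[OF vT _ _ bound] by blast
qed

text \<open>The setting restricts only the eigenvalues, while the estimates need the quadratic form.
  The lower bound comes from the smallest eigenvalue of \<open>A\<close>, the upper one from that of
  \<open>- A\<close>; the space {0} has no eigenvector and is treated apart.\<close>

lemma quadratic_form_bounds:
  fixes T :: "'a::euclidean_space set"
  assumes T: "subspace T" and A: "linear A" "\<And>\<xi>. \<xi> \<in> T \<Longrightarrow> A \<xi> \<in> T"
    and sym: "\<And>\<xi> \<xi>'. \<xi> \<in> T \<Longrightarrow> \<xi>' \<in> T \<Longrightarrow> inner (A \<xi>) \<xi>' = inner \<xi> (A \<xi>')"
    and eig: "\<And>\<xi> lam. \<xi> \<in> T \<Longrightarrow> \<xi> \<noteq> 0 \<Longrightarrow> A \<xi> = lam *\<^sub>R \<xi> \<Longrightarrow> \<kappa> \<le> lam \<and> lam \<le> \<kappa>'"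
    and \<xi>: "\<xi> \<in> T"
  shows "\<kappa> * (norm \<xi>)\<^sup>2 \<le> inner \<xi> (A \<xi>)" "inner \<xi> (A \<xi>) \<le> \<kappa>' * (norm \<xi>)\<^sup>2"
proof -
  have "\<kappa> * (norm \<xi>)\<^sup>2 \<le> inner \<xi> (A \<xi>) \<and> inner \<xi> (A \<xi>) \<le> \<kappa>' * (norm \<xi>)\<^sup>2"
  proof (cases "T = {0}")
    case False
    obtain m v where v: "v \<in> T" "v \<noteq> 0" "A v = m *\<^sub>R v" "m * (norm \<xi>)\<^sup>2 \<le> inner \<xi> (A \<xi>)"
      by (rule min_eigenvector_exists[OF T False A sym]) (use \<xi> in auto)
    obtain m' v' where v': "v' \<in> T" "v' \<noteq> 0" "- A v' = m' *\<^sub>R v'" "m' * (norm \<xi>)\<^sup>2 \<le> inner \<xi> (- A \<xi>)"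
      by (rule min_eigenvector_exists[OF T False, of "\<lambda>\<xi>. - A \<xi>"])
        (use A sym \<xi> T in \<open>auto intro: linear_compose_neg subspace_neg\<close>)
    have "A v' = (- m') *\<^sub>R v'" using v'(3) by (metis minus_minus scaleR_minus_left)
    then have "- m' \<le> \<kappa>'" using eig v' by blast
    then have "- m' * (norm \<xi>)\<^sup>2 \<le> \<kappa>' * (norm \<xi>)\<^sup>2" by (intro mult_right_mono) auto
    moreover have "\<kappa> * (norm \<xi>)\<^sup>2 \<le> m * (norm \<xi>)\<^sup>2" using eig v by (intro mult_right_mono) auto
    ultimately show ?thesis using v(4) v'(4) by simp
  qed (use \<xi> linear_0[OF A(1)] in auto)
  then show "\<kappa> * (norm \<xi>)\<^sup>2 \<le> inner \<xi> (A \<xi>)" "inner \<xi> (A \<xi>) \<le> \<kappa>' * (norm \<xi>)\<^sup>2" by auto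
qed

section \<open>Growth and local Lipschitz bounds for convex functions\<close>

lemma convex_on_segment_le:
  assumes "convex_on UNIV g" "0 \<le> s" "s \<le> (1::real)"
  shows "g (z + s *\<^sub>R \<xi>) \<le> (1 - s) * g z + s * g (z + \<xi>)"
proof -
  have "z + s *\<^sub>R \<xi> = (1 - s) *\<^sub>R z + s *\<^sub>R (z + \<xi>)" by (simp add: algebra_simps)
  then show ?thesis using convex_onD[OF assms(1), of s z "z + \<xi>"] assms by simp
qed

text \<open>The slope of \<open>g\<close> from \<open>z\<close> to \<open>z + \<xi>\<close> is at
  least its slope over the first unit of the way, which is at least -2 K. A convex function thus
  falls at most linearly, so the quadratic term of the subproblem dominates it.\<close>

lemma convex_on_linear_lower_bound:
  fixes g :: "'a::real_normed_vector \<Rightarrow> real"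
  assumes g: "convex_on UNIV g" and K: "\<And>w. w \<in> cball z 1 \<Longrightarrow> \<bar>g w\<bar> \<le> K" and \<xi>: "norm \<xi> \<ge> 1"
  shows "g z - 2 * K * norm \<xi> \<le> g (z + \<xi>)"
proof -
  let ?s = "1 / norm \<xi>"
  have \<xi>0: "norm \<xi> > 0" using \<xi> by linarith
  have "g (z + ?s *\<^sub>R \<xi>) \<le> (1 - ?s) * g z + ?s * g (z + \<xi>)"
    using \<xi> \<xi>0 by (intro convex_on_segment_le g) (auto simp: field_simps)
  then have "norm \<xi> * g (z + ?s *\<^sub>R \<xi>) \<le> norm \<xi> * ((1 - ?s) * g z + ?s * g (z + \<xi>))"
    using \<xi>0 by (intro mult_left_mono) auto
  also have "\<dots> = (norm \<xi> - 1) * g z + g (z + \<xi>)" using \<xi>0 by (simp add: algebra_simps)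
  finally have "norm \<xi> * (g (z + ?s *\<^sub>R \<xi>) - g z) + g z \<le> g (z + \<xi>)" by (simp add: algebra_simps)
  moreover have "- (2 * K) \<le> g (z + ?s *\<^sub>R \<xi>) - g z"
    using K[of "z + ?s *\<^sub>R \<xi>"] K[of z] \<xi>0 by (simp add: dist_norm abs_le_iff)
  then have "norm \<xi> * (- (2 * K)) \<le> norm \<xi> * (g (z + ?s *\<^sub>R \<xi>) - g z)"
    by (intro mult_left_mono) auto
  ultimately show ?thesis by (simp add: algebra_simps)
qed

text \<open>The segment from \<open>b\<close> to \<open>a\<close> is prolonged by one unit beyond
  \<open>a\<close> to a point \<open>e\<close> of the larger ball. Convexity bounds the slope from
  \<open>b\<close> to \<open>a\<close> by that from \<open>b\<close> to \<open>e\<close>, where the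
  distance is at least 1 and the values differ by at most 2 K.\<close>

lemma convex_on_lipschitz_cball:
  fixes g :: "'a::real_normed_vector \<Rightarrow> real"
  assumes g: "convex_on UNIV g" and K: "\<And>w. w \<in> cball c (r + 1) \<Longrightarrow> \<bar>g w\<bar> \<le> K"
    and ab: "a \<in> cball c r" "b \<in> cball c r"
  shows "\<bar>g a - g b\<bar> \<le> 2 * K * norm (a - b)"
proof -
  have *: "g a - g b \<le> 2 * K * norm (a - b)" if ab: "a \<in> cball c r" "b \<in> cball c r" for a b
  proof (cases "a = b")
    case False
    define n where "n = norm (a - b)"
    have n: "n > 0" using False n_def by simp
    define e where "e = a + (1 / n) *\<^sub>R (a - b)"
    have ne: "norm ((1 / n) *\<^sub>R (a - b)) = 1" using False by (simp add: n_def)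
    have "dist c e \<le> dist c a + dist a e" by (rule dist_triangle)
    also have "dist a e = 1" using ne by (simp add: e_def dist_norm del: norm_scaleR)
    finally have eb: "e \<in> cball c (r + 1)" using ab by simp
    have "b + (n / (1 + n)) *\<^sub>R (e - b) = a"
    proof -
      have "e - b = (1 + 1 / n) *\<^sub>R (a - b)" by (simp add: e_def algebra_simps)
      then have "(n / (1 + n)) *\<^sub>R (e - b) = ((n / (1 + n)) * (1 + 1 / n)) *\<^sub>R (a - b)" by simp
      also have "(n / (1 + n)) * (1 + 1 / n) = 1"
      proof -
        have "1 + n \<noteq> 0" "n \<noteq> 0" "1 + 1 / n = (1 + n) / n" using n by (auto simp: field_simps)
        then show ?thesis by simp
      qed
      finally show ?thesis by simp
    qed
    then have "g a \<le> (1 - n / (1 + n)) * g b + (n / (1 + n)) * g (b + (e - b))"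
      using convex_on_segment_le[OF g, of "n / (1 + n)" b "e - b"] n by simp
    then have "g a - g b \<le> (n / (1 + n)) * (g e - g b)" by (simp add: algebra_simps diff_divide_distrib)
    also have "\<dots> \<le> (n / (1 + n)) * (2 * K)"
      using K[OF eb] K[of b] ab n by (intro mult_left_mono) auto
    also have "\<dots> \<le> n * (2 * K)"
      using K[OF eb] n by (intro mult_right_mono) (auto simp: field_simps)
    finally show ?thesis by (simp add: n_def mult.commute)
  qed simp
  show ?thesis using *[OF ab] *[OF ab(2) ab(1)] by (simp add: norm_minus_commute abs_le_iff)
qed

section \<open>The proximal subproblem at one point\<close>

locale prox_model =
  fixes T :: "'a::euclidean_space set" and A :: "'a \<Rightarrow> 'a" and g :: "'a \<Rightarrow> real"
    and a z :: 'a and \<mu> \<kappa> :: real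
  assumes T: "subspace T" and A: "linear A"
    and coercive: "\<And>\<xi>. \<xi> \<in> T \<Longrightarrow> \<kappa> * (norm \<xi>)\<^sup>2 \<le> inner \<xi> (A \<xi>)"
    and \<kappa>_pos: "0 < \<kappa>" and \<mu>_pos: "0 < \<mu>"
    and g_cont: "continuous_on UNIV g" and g_convex: "convex_on UNIV g"
begin

text \<open>Here \<open>a\<close>, \<open>z\<close> and \<open>T\<close> stand for the Riemannian
  gradient, the base point and its tangent space, and \<open>A\<close> for a weight that has been
  extended to a linear map on the whole space.\<close>

definition model :: "'a \<Rightarrow> real" where
  "model \<xi> = inner a \<xi> + inner \<xi> (A \<xi>) / (2 * \<mu>) + g (z + \<xi>)"

lemma model_0: "model 0 = g z"
  by (simp add: model_def linear_0[OF A])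

lemma continuous_model: "continuous_on S model"
  unfolding model_def
  by (intro continuous_intros linear_continuous_on continuous_on_compose2[OF g_cont])
    (use A \<mu>_pos in \<open>auto simp: linear_conv_bounded_linear[symmetric]\<close>)

text \<open>Quadratic growth with factor \<kappa> / (2 \<mu>) beats the linear terms
  \<open>norm a\<close> and \<open>2 * K\<close>. The bound depends on the point only through
  \<open>norm a\<close> and \<open>K\<close>, hence can be made uniform over a compact
  manifold.\<close>

lemma sublevel_bound:
  assumes K: "\<And>w. w \<in> cball z 1 \<Longrightarrow> \<bar>g w\<bar> \<le> K" and \<xi>: "\<xi> \<in> T" "model \<xi> \<le> g z"
  shows "norm \<xi> \<le> 1 + 2 * \<mu> * (norm a + 2 * K) / \<kappa>"
proof (cases "norm \<xi> \<le> 1")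
  case True
  have "0 \<le> K" using K[of z] by auto
  then have "0 \<le> 2 * \<mu> * (norm a + 2 * K) / \<kappa>" using \<kappa>_pos \<mu>_pos by simp
  then show ?thesis using True by linarith
next
  case False
  have "g z - 2 * K * norm \<xi> \<le> g (z + \<xi>)"
    using False by (intro convex_on_linear_lower_bound g_convex K) auto
  moreover have "- (norm a * norm \<xi>) \<le> inner a \<xi>"
    using Cauchy_Schwarz_ineq2[of a \<xi>] by linarith
  moreover have "\<kappa> * (norm \<xi>)\<^sup>2 / (2 * \<mu>) \<le> inner \<xi> (A \<xi>) / (2 * \<mu>)"
    using coercive[OF \<xi>(1)] \<mu>_pos by (intro divide_right_mono) auto
  ultimately have "\<kappa> * (norm \<xi>)\<^sup>2 / (2 * \<mu>) \<le> (norm a + 2 * K) * norm \<xi>"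
    using \<xi>(2) by (simp add: model_def algebra_simps)
  then have "norm \<xi> * (\<kappa> * norm \<xi>) \<le> norm \<xi> * (2 * \<mu> * (norm a + 2 * K))"
    using \<mu>_pos by (simp add: field_simps power2_eq_square)
  then have "\<kappa> * norm \<xi> \<le> 2 * \<mu> * (norm a + 2 * K)"
    using False by (simp only: mult_le_cancel_left_pos)
  then have "norm \<xi> \<le> 2 * \<mu> * (norm a + 2 * K) / \<kappa>"
    using \<kappa>_pos by (simp add: field_simps)
  then show ?thesis by simp
qed

lemma minimizer_exists: "\<exists>\<eta>\<in>T. \<forall>\<xi>\<in>T. model \<eta> \<le> model \<xi>"
proof -
  have "compact (g ` cball z 1)"
    by (intro compact_continuous_image continuous_on_subset[OF g_cont]) auto
  then obtain K where K: "\<And>w. w \<in> cball z 1 \<Longrightarrow> \<bar>g w\<bar> \<le> K"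
    using compact_imp_bounded bounded_iff by (metis imageI real_norm_def)
  define C where "C = 1 + 2 * \<mu> * (norm a + 2 * K) / \<kappa>"
  have C: "norm \<xi> \<le> C" if "\<xi> \<in> T" "model \<xi> \<le> model 0" for \<xi>
    using sublevel_bound[OF K, of \<xi>] that by (simp add: model_0 C_def)
  have 0: "0 \<in> T \<inter> cball 0 C" using C[of 0] subspace_0[OF T] by simp
  have "compact (T \<inter> cball 0 C)" using closed_subspace[OF T] by (intro closed_Int_compact) auto
  then obtain \<eta> where \<eta>: "\<eta> \<in> T \<inter> cball 0 C" "\<forall>\<xi> \<in> T \<inter> cball 0 C. model \<eta> \<le> model \<xi>"
    using continuous_attains_inf[OF _ _ continuous_model] 0 by blast
  have "model \<eta> \<le> model \<xi>" if "\<xi> \<in> T" for \<xi>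
  proof (cases "model \<xi> \<le> model 0")
    case True
    then show ?thesis using C[OF that True] \<eta>(2) that by auto
  next
    case False
    then show ?thesis using bspec[OF \<eta>(2) 0] by linarith
  qed
  then show ?thesis using \<eta> by blast
qed

text \<open>At the midpoint \<open>m\<close> of two minimisers, \<open>g\<close> is at most its
  average, the linear term equals its average, and the quadratic term falls below its average by the
  positive amount \<open>D\<close>.\<close>

lemma minimizer_unique:
  assumes x: "x \<in> T" "\<forall>\<xi>\<in>T. model x \<le> model \<xi>" and y: "y \<in> T" "\<forall>\<xi>\<in>T. model y \<le> model \<xi>"
  shows "x = y"
proof (rule ccontr)
  assume "x \<noteq> y"
  define m where "m = x + (1/2) *\<^sub>R (y - x)"
  have mT: "m \<in> T" unfolding m_def using x y T by (intro subspace_add subspace_scale subspace_diff)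
  have m2: "m = (1/2) *\<^sub>R (x + y)"
  proof -
    have "2 *\<^sub>R m = x + y" by (simp add: m_def algebra_simps scaleR_2)
    then show ?thesis by (metis scaleR_half_double scaleR_2 scaleR_right_distrib)
  qed
  have "g (z + m) \<le> (g (z + x) + g (z + y)) / 2"
    using convex_on_segment_le[OF g_convex, of "1/2" "z + x" "y - x"] by (simp add: m_def add.assoc)
  moreover have "inner m (A m) = (inner x (A x) + inner y (A y)) / 2 - inner (x - y) (A (x - y)) / 4"
    unfolding m2 by (simp add: linear_cmul[OF A] linear_add[OF A] linear_diff[OF A]
      inner_add_left inner_add_right inner_diff_left inner_diff_right field_simps)
  then have "inner m (A m) / (2 * \<mu>) = (inner x (A x) / (2 * \<mu>) + inner y (A y) / (2 * \<mu>)) / 2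
      - inner (x - y) (A (x - y)) / (8 * \<mu>)"
    by (simp add: add_divide_distrib diff_divide_distrib)
  moreover have "inner a m = (inner a x + inner a y) / 2" by (simp add: m2 inner_add_right)
  moreover define D where "D = inner (x - y) (A (x - y)) / (8 * \<mu>)"
  ultimately have "model m \<le> (model x + model y) / 2 - D"
    unfolding model_def D_def by argo
  moreover have "D > 0"
  proof -
    have "0 < \<kappa> * (norm (x - y))\<^sup>2" using \<open>x \<noteq> y\<close> \<kappa>_pos by simp
    also have "\<dots> \<le> inner (x - y) (A (x - y))" using x y T by (intro coercive subspace_diff)
    finally show ?thesis using \<mu>_pos by (simp add: D_def)
  qed
  moreover have "model x \<le> model m" "model y \<le> model m" using x y mT by auto
  ultimately show False by argo
qed

text \<open>Comparing \<open>\<eta>\<close> with \<open>s *\<^sub>R \<eta>\<close> and dividing by 1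
  - s gives the bound -(1 + s) q, with q the quadratic term; as s tends to 1 this becomes -2 q. The
  comparison with 0, that is s = 0, would give only -q and hence half of \<kappa> / \<mu>.\<close>

lemma minimizer_decrease:
  assumes \<eta>: "\<eta> \<in> T" "\<forall>\<xi>\<in>T. model \<eta> \<le> model \<xi>"
  shows "inner a \<eta> + g (z + \<eta>) - g z \<le> - (\<kappa> / \<mu>) * (norm \<eta>)\<^sup>2"
proof -
  define q where "q = inner \<eta> (A \<eta>) / (2 * \<mu>)"
  define b where "b = inner a \<eta> + g (z + \<eta>) - g z"
  have "b \<le> - (1 + s) * q" if s: "0 < s" "s < 1" for s
  proof -
    have "model \<eta> \<le> model (s *\<^sub>R \<eta>)" using \<eta> T by (simp add: subspace_scale)
    moreover have "model \<eta> = inner a \<eta> + q + g (z + \<eta>)" by (simp add: model_def q_def)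
    moreover have "model (s *\<^sub>R \<eta>) = s * inner a \<eta> + s\<^sup>2 * q + g (z + s *\<^sub>R \<eta>)"
      by (simp add: model_def linear_cmul[OF A] q_def power2_eq_square)
    moreover have "g (z + s *\<^sub>R \<eta>) \<le> (1 - s) * g z + s * g (z + \<eta>)"
      using s by (intro convex_on_segment_le g_convex) auto
    ultimately have "(1 - s) * b \<le> (1 - s) * (- (1 + s) * q)"
      by (simp add: b_def algebra_simps power2_eq_square)
    then show ?thesis using s by simp
  qed
  then have "eventually (\<lambda>s. b \<le> - (1 + s) * q) (at_left 1)"
    using eventually_at_left_real[of 0 1] by (auto elim: eventually_mono)
  moreover have "((\<lambda>s. - (1 + s) * q) \<longlongrightarrow> - (1 + 1) * q) (at_left 1)" by (intro tendsto_intros)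
  ultimately have "b \<le> - 2 * q" using tendsto_lowerbound[of "\<lambda>s. - (1 + s) * q"] by fastforce
  also have "\<dots> = - (inner \<eta> (A \<eta>) / \<mu>)" using \<mu>_pos by (simp add: q_def)
  also have "\<dots> \<le> - (\<kappa> * (norm \<eta>)\<^sup>2 / \<mu>)"
    using coercive[OF \<eta>(1)] \<mu>_pos by (simp add: divide_right_mono)
  finally show ?thesis by (simp add: b_def)
qed

end

section \<open>Sufficient decrease for inexact steps\<close>

lemma lipschitz_gradient_upper_bound:
  fixes f :: "'a::euclidean_space \<Rightarrow> real"
  assumes f: "\<And>u. (f has_derivative (\<lambda>h. inner (nf u) h)) (at u)"
    and lip: "\<And>u v. norm (nf u - nf v) \<le> L * norm (u - v)" and L: "L \<ge> 0"
  shows "f y \<le> f x + inner (nf x) (y - x) + L * (norm (y - x))\<^sup>2"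
proof -
  \<comment> \<open>The mean value theorem replaces integration of the gradient. It gives L where
    integration gives L / 2, which suffices because the step lengths may be taken as small as
    necessary.\<close>
  have "\<exists>s\<in>{0<..<1}. f (x + 1 *\<^sub>R (y - x)) - f (x + 0 *\<^sub>R (y - x)) = inner (nf (x + s *\<^sub>R (y - x))) ((1 - 0) *\<^sub>R (y - x))"
  proof (rule mvt_simple[of 0 1 "\<lambda>s. f (x + s *\<^sub>R (y - x))" "\<lambda>s h. inner (nf (x + s *\<^sub>R (y - x))) (h *\<^sub>R (y - x))"])
    fix s :: real
    have "((\<lambda>s. x + s *\<^sub>R (y - x)) has_derivative (\<lambda>h. h *\<^sub>R (y - x))) (at s within {0..1})"
      by (auto intro!: derivative_eq_intros)
    then show "((\<lambda>s. f (x + s *\<^sub>R (y - x))) has_derivative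
        (\<lambda>h. inner (nf (x + s *\<^sub>R (y - x))) (h *\<^sub>R (y - x)))) (at s within {0..1})"
      by (rule has_derivative_compose[OF _ f])
  qed simp
  then obtain s where s: "0 < s" "s < 1" "f y - f x = inner (nf (x + s *\<^sub>R (y - x))) (y - x)" by auto
  have "inner (nf (x + s *\<^sub>R (y - x)) - nf x) (y - x) \<le> norm (nf (x + s *\<^sub>R (y - x)) - nf x) * norm (y - x)"
    by (rule norm_cauchy_schwarz)
  also have "\<dots> \<le> (L * norm (y - x)) * norm (y - x)"
  proof (intro mult_right_mono norm_ge_zero)
    have "norm (nf (x + s *\<^sub>R (y - x)) - nf x) \<le> L * norm (s *\<^sub>R (y - x))"
      using lip[of "x + s *\<^sub>R (y - x)" x] by simp
    also have "\<dots> \<le> L * norm (y - x)"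
      using s L by (intro mult_left_mono) (auto intro: mult_left_le_one_le)
    finally show "norm (nf (x + s *\<^sub>R (y - x)) - nf x) \<le> L * norm (y - x)" .
  qed
  finally show ?thesis using s(3) by (simp add: inner_diff_left power2_eq_square)
qed

text \<open>\<open>y\<close> plays the retracted point, off the straight step by a fraction
  \<open>e\<close> of its length. The surplus (c - \<sigma>) \<alpha> |\<eta>|^2 over the required
  decrease is split in halves: one pays for this deviation, at Lipschitz cost G + K, the other for
  the quadratic remainder of \<open>f\<close>, where |y - z| \<le> 2 \<alpha> |\<eta>| produces the
  factor 4 L.\<close>

lemma approximate_step_sufficient_decrease:
  fixes f g :: "'a::euclidean_space \<Rightarrow> real"
  assumes f: "\<And>u. (f has_derivative (\<lambda>h. inner (nf u) h)) (at u)"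
    and lip: "\<And>u v. norm (nf u - nf v) \<le> L * norm (u - v)" and L: "L \<ge> 0"
    and g: "convex_on UNIV g" and glip: "\<bar>g y - g (z + \<alpha> *\<^sub>R \<eta>)\<bar> \<le> K * norm (y - (z + \<alpha> *\<^sub>R \<eta>))"
    and K: "0 \<le> K" and G: "norm (nf z) \<le> G"
    and \<alpha>: "0 < \<alpha>" "\<alpha> \<le> 1" and e: "0 \<le> e" "e \<le> 1"
    and y: "norm (y - z - \<alpha> *\<^sub>R \<eta>) \<le> e * norm (\<alpha> *\<^sub>R \<eta>)"
    and dec: "inner (nf z) \<eta> + g (z + \<eta>) - g z \<le> - c * (norm \<eta>)\<^sup>2"
    and small: "(G + K) * e \<le> (c - \<sigma>) / 2 * norm \<eta>" "4 * L * \<alpha> \<le> (c - \<sigma>) / 2"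
  shows "f y + g y \<le> f z + g z - \<sigma> * \<alpha> * (norm \<eta>)\<^sup>2"
proof -
  let ?n = "norm \<eta>"
  have ny: "norm (y - z - \<alpha> *\<^sub>R \<eta>) \<le> e * (\<alpha> * ?n)" using y \<alpha> by simp
  have "norm (y - z) \<le> norm (y - z - \<alpha> *\<^sub>R \<eta>) + norm (\<alpha> *\<^sub>R \<eta>)"
    using norm_triangle_ineq[of "y - z - \<alpha> *\<^sub>R \<eta>" "\<alpha> *\<^sub>R \<eta>"] by simp
  also have "\<dots> \<le> 1 * (\<alpha> * ?n) + \<alpha> * ?n"
    using ny \<alpha> e by (intro add_mono order_trans[OF ny] mult_right_mono) auto
  finally have nyz: "norm (y - z) \<le> 2 * (\<alpha> * ?n)" by simp
  have "L * (norm (y - z))\<^sup>2 \<le> L * (2 * (\<alpha> * ?n))\<^sup>2"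
    using nyz L by (intro mult_left_mono power_mono) auto
  also have "\<dots> = (4 * L * \<alpha>) * (\<alpha> * ?n\<^sup>2)" by (simp add: power2_eq_square)
  also have "\<dots> \<le> ((c - \<sigma>) / 2) * (\<alpha> * ?n\<^sup>2)"
    using small(2) \<alpha> by (intro mult_right_mono) auto
  finally have quad: "L * (norm (y - z))\<^sup>2 \<le> ((c - \<sigma>) / 2) * (\<alpha> * ?n\<^sup>2)" .
  have "inner (nf z) (y - z) = \<alpha> * inner (nf z) \<eta> + inner (nf z) (y - z - \<alpha> *\<^sub>R \<eta>)"
    by (simp add: inner_diff_right)
  also have "inner (nf z) (y - z - \<alpha> *\<^sub>R \<eta>) \<le> norm (nf z) * norm (y - z - \<alpha> *\<^sub>R \<eta>)"
    by (rule norm_cauchy_schwarz)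
  also have "\<dots> \<le> G * (e * (\<alpha> * ?n))"
    using ny G order_trans[OF norm_ge_zero G] by (intro mult_mono) auto
  finally have lin: "inner (nf z) (y - z) \<le> \<alpha> * inner (nf z) \<eta> + G * (e * (\<alpha> * ?n))" by simp
  have "g y \<le> g (z + \<alpha> *\<^sub>R \<eta>) + K * norm (y - z - \<alpha> *\<^sub>R \<eta>)" using glip by (simp add: diff_diff_eq)
  also have "\<dots> \<le> ((1 - \<alpha>) * g z + \<alpha> * g (z + \<eta>)) + K * (e * (\<alpha> * ?n))"
    using convex_on_segment_le[OF g, of \<alpha> z \<eta>] \<alpha> ny K by (intro add_mono mult_left_mono) auto
  finally have gy: "g y \<le> g z + \<alpha> * (g (z + \<eta>) - g z) + K * (e * (\<alpha> * ?n))" by (simp add: algebra_simps)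
  have "((G + K) * e) * (\<alpha> * ?n) \<le> ((c - \<sigma>) / 2 * ?n) * (\<alpha> * ?n)"
    using small(1) \<alpha> by (intro mult_right_mono) auto
  then have err: "G * (e * (\<alpha> * ?n)) + K * (e * (\<alpha> * ?n)) \<le> ((c - \<sigma>) / 2) * (\<alpha> * ?n\<^sup>2)"
    by (simp add: algebra_simps power2_eq_square)
  have "\<alpha> * (inner (nf z) \<eta> + g (z + \<eta>) - g z) \<le> \<alpha> * (- c * ?n\<^sup>2)"
    using dec \<alpha> by (intro mult_left_mono) auto
  then have main: "\<alpha> * inner (nf z) \<eta> + \<alpha> * (g (z + \<eta>) - g z) \<le> - c * (\<alpha> * ?n\<^sup>2)"
    by (simp add: algebra_simps)
  have "f y \<le> f z + inner (nf z) (y - z) + L * (norm (y - z))\<^sup>2"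
    by (rule lipschitz_gradient_upper_bound[OF f lip L])
  then have "f y + g y \<le> f z + g z - c * (\<alpha> * ?n\<^sup>2) + 2 * (((c - \<sigma>) / 2) * (\<alpha> * ?n\<^sup>2))"
    using quad lin gy err main by linarith
  also have "\<dots> = f z + g z - \<sigma> * \<alpha> * ?n\<^sup>2" by (simp add: field_simps)
  finally show ?thesis .
qed

section \<open>From first-order optimality to the Clarke subdifferential\<close>

lemma convex_subgradient_normal_to_subspace:
  fixes g :: "'a::euclidean_space \<Rightarrow> real"
  assumes g: "convex_on UNIV g" and T: "subspace T"
    and opt: "\<And>\<xi>. \<xi> \<in> T \<Longrightarrow> g z \<le> inner a \<xi> + g (z + \<xi>)"
  obtains v where "\<And>y. g z + inner v (y - z) \<le> g y" "\<And>\<xi>. \<xi> \<in> T \<Longrightarrow> inner (a + v) \<xi> = 0"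
proof -
  \<comment> \<open>\<open>S\<close> is the graph over z + T of the affine function with slope - a,
    and \<open>opt\<close> says that it misses the strict epigraph \<open>E\<close>. The hyperplane
    separating them is the graph of an affine minorant of \<open>g\<close> with the same slope along
    \<open>T\<close>.\<close>
  define S where "S = (\<lambda>\<xi>. (z, g z) + (\<xi>, - inner a \<xi>)) ` T"
  define E where "E = {w :: 'a \<times> real. g (fst w) < snd w}"
  have "linear (\<lambda>\<xi>. (\<xi>, - inner a \<xi>))" by (rule linearI) (auto simp: inner_add_right)
  then have "convex ((\<lambda>\<xi>. (\<xi>, - inner a \<xi>)) ` T)"
    by (intro subspace_imp_convex linear_subspace_image T)
  moreover have "S = (+) (z, g z) ` ((\<lambda>\<xi>. (\<xi>, - inner a \<xi>)) ` T)" unfolding S_def by (simp add: image_image)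
  ultimately have S: "convex S" by (metis convex_translation)
  have E: "convex E"
  proof (rule convexI)
    fix p q :: "'a \<times> real" and u v :: real
    assume pq: "p \<in> E" "q \<in> E" and uv: "0 \<le> u" "0 \<le> v" "u + v = 1"
    have "g (u *\<^sub>R fst p + v *\<^sub>R fst q) \<le> u * g (fst p) + v * g (fst q)"
      using g uv by (auto simp: convex_on_def)
    also have "\<dots> < u * snd p + v * snd q"
    proof (cases "u = 0")
      case True then show ?thesis using pq uv by (simp add: E_def)
    next
      case False
      then show ?thesis using pq uv unfolding E_def
        by (intro add_less_le_mono mult_strict_left_mono mult_left_mono) auto
    qed
    finally show "u *\<^sub>R p + v *\<^sub>R q \<in> E" by (simp add: E_def)
  qed
  have disj: "E \<inter> S = {}" using opt by (force simp: E_def S_def)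
  have "(z, g z) \<in> S" unfolding S_def using subspace_0[OF T] by (force simp: image_iff)
  moreover have "(z, g z + 1) \<in> E" by (simp add: E_def)
  ultimately obtain pr b where pr: "pr \<noteq> 0" "\<forall>w\<in>S. inner pr w \<le> b" "\<forall>w\<in>E. b \<le> inner pr w"
    using separating_hyperplane_sets[OF S E] disj by blast
  obtain p r where pr_eq: "pr = (p, r)" by fastforce
  have up: "b \<le> inner p y + r * s" if "g y < s" for y s
    using pr(3) that by (auto simp: E_def pr_eq)
  have lo: "inner p (z + \<xi>) + r * (g z - inner a \<xi>) \<le> b" if "\<xi> \<in> T" for \<xi>
    using pr(2) that by (auto simp: S_def pr_eq algebra_simps)
  have r0: "r \<ge> 0"
  proof (rule ccontr)
    assume "\<not> r \<ge> 0"
    define s where "s = max (g z + 1) ((b - inner p z - 1) / r)"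
    have "(b - inner p z - 1) / r \<le> s" by (simp add: s_def)
    then have "r * s \<le> b - inner p z - 1" using \<open>\<not> r \<ge> 0\<close> by (simp add: field_simps)
    moreover have "b \<le> inner p z + r * s" by (rule up) (simp add: s_def)
    ultimately show False by simp
  qed
  \<comment> \<open>A vertical hyperplane is impossible because \<open>g\<close> is finite
    everywhere: \<open>E\<close> has points above all of the space, in particular above
    \<open>z - p\<close>.\<close>
  have rp: "r > 0"
  proof (rule ccontr)
    assume "\<not> r > 0"
    then have r: "r = 0" using r0 by simp
    then have "p \<noteq> 0" using pr(1) pr_eq by (simp add: zero_prod_def)
    have "b \<le> inner p (z - p)" using up[of "z - p" "g (z - p) + 1"] r by simp
    moreover have "inner p z \<le> b" using lo[OF subspace_0[OF T]] r by simp
    moreover have "inner p p > 0" using \<open>p \<noteq> 0\<close> by simp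
    ultimately show False by (simp add: inner_diff_right)
  qed
  \<comment> \<open>\<open>E\<close> is the strict epigraph, so the graph itself is reached by
    letting the excess \<open>e / r\<close> tend to 0.\<close>
  have up': "b \<le> inner p y + r * g y" for y
  proof (rule field_le_epsilon)
    fix e :: real assume "e > 0"
    then have "b \<le> inner p y + r * (g y + e / r)" using rp by (intro up) simp
    then show "b \<le> inner p y + r * g y + e" using rp by (simp add: algebra_simps)
  qed
  define v where "v = - (p /\<^sub>R r)"
  have pv: "inner p w = - (r * inner v w)" for w using rp by (simp add: v_def)
  have "g z + inner v (y - z) \<le> g y" for y
  proof -
    have "inner p z + r * g z \<le> inner p y + r * g y" using lo[OF subspace_0[OF T]] up'[of y] by simp
    then have "r * (g z + inner v (y - z)) \<le> r * g y" by (simp add: pv inner_diff_right algebra_simps)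
    then show ?thesis using rp by simp
  qed
  moreover have le: "inner (a + v) \<xi> \<ge> 0" if "\<xi> \<in> T" for \<xi>
  proof -
    have "inner p (z + \<xi>) + r * (g z - inner a \<xi>) \<le> inner p z + r * g z" using lo[OF that] up'[of z] by simp
    then have "0 \<le> r * inner (a + v) \<xi>" by (simp add: pv inner_add_right inner_add_left algebra_simps)
    then show ?thesis using rp by (simp add: zero_le_mult_iff)
  qed
  \<comment> \<open>\<open>T\<close> contains the negative of each of its vectors, which turns the
    inequality into an equality.\<close>
  have "inner (a + v) \<xi> = 0" if "\<xi> \<in> T" for \<xi>
    using le[OF that] le[OF subspace_neg[OF T that]] by simp
  ultimately show ?thesis using that by blast
qed

text \<open>The Clarke derivative is an upper limit over base points and step sizes, so it dominates
  what happens along the path that keeps the base point at \<open>x\<close>. There the quotient of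
  \<open>f\<close> tends to its derivative and that of \<open>g\<close> is at least
  \<open>inner v h\<close>.\<close>

lemma gradient_plus_subgradient_in_clarke_subdiff:
  fixes f g :: "'a::real_inner \<Rightarrow> real"
  assumes f: "(f has_derivative (\<lambda>h. inner n h)) (at x)"
    and v: "\<And>y. g x + inner v (y - x) \<le> g y"
  shows "n + v \<in> clarke_subdiff (\<lambda>u. f u + g u) x"
  unfolding clarke_subdiff_def
proof (intro CollectI allI)
  fix h
  let ?Q = "\<lambda>(y, s). ereal ((f (y + s *\<^sub>R h) + g (y + s *\<^sub>R h) - (f y + g y)) / s)"
  let ?F = "at (x, 0::real) within (UNIV \<times> {0<..})"
  have der: "((\<lambda>s. f (x + s *\<^sub>R h)) has_real_derivative inner n h) (at 0)"
  proof -
    have "((\<lambda>s. x + s *\<^sub>R h) has_derivative (\<lambda>s. s *\<^sub>R h)) (at (0::real))"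
      by (auto intro!: derivative_eq_intros)
    moreover have "(f has_derivative (\<lambda>h. inner n h)) (at (x + 0 *\<^sub>R h))" using f by simp
    ultimately have "((\<lambda>s. f (x + s *\<^sub>R h)) has_derivative (\<lambda>s. inner n (s *\<^sub>R h))) (at 0)"
      by (rule has_derivative_compose)
    then show ?thesis by (simp add: has_field_derivative_def mult_commute_abs)
  qed
  then have "((\<lambda>s. (f (x + s *\<^sub>R h) - f x) / s) \<longlongrightarrow> inner n h) (at 0)"
    by (simp add: DERIV_def)
  then have lim: "((\<lambda>s. (f (x + s *\<^sub>R h) - f x) / s) \<longlongrightarrow> inner n h) (at_right 0)"
    using filterlim_at_split by blast
  have path: "filterlim (\<lambda>s. (x, s)) ?F (at_right (0::real))"
    unfolding filterlim_at
  proof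
    show "eventually (\<lambda>s::real. (x, s) \<in> UNIV \<times> {0<..} \<and> (x, s) \<noteq> (x, 0)) (at_right 0)"
      using eventually_at_right_less by eventually_elim simp
  qed (intro tendsto_Pair tendsto_const tendsto_ident_at)
  show "ereal (inner (n + v) h) \<le> clarke_dd (\<lambda>u. f u + g u) x h"
    unfolding clarke_dd_def
  proof (rule ccontr)
    assume "\<not> ereal (inner (n + v) h) \<le> Limsup ?F ?Q"
    then have "Limsup ?F ?Q < ereal (inner (n + v) h)" by (simp only: not_le)
    from dense[OF this] obtain C where C: "Limsup ?F ?Q < C" "C < ereal (inner (n + v) h)"
      by (elim exE conjE) (rule that)
    have "eventually (\<lambda>p. ?Q p < C) ?F" using C(1) by (rule Limsup_lessD)
    then have "eventually (\<lambda>s. ?Q (x, s) < C) (at_right 0)"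
      by (rule eventually_compose_filterlim[OF _ path])
    moreover have "eventually (\<lambda>s::real. s > 0) (at_right 0)" by (simp add: eventually_at_right_less)
    ultimately have ev: "eventually (\<lambda>s. ereal ((f (x + s *\<^sub>R h) - f x) / s + inner v h) \<le> C) (at_right 0)"
    proof eventually_elim
      case (elim s)
      have "s * inner v h \<le> g (x + s *\<^sub>R h) - g x" using v[of "x + s *\<^sub>R h"] by simp
      then have "inner v h \<le> (g (x + s *\<^sub>R h) - g x) / s" using elim(2) by (simp add: field_simps)
      then have "(f (x + s *\<^sub>R h) - f x) / s + inner v h
          \<le> (f (x + s *\<^sub>R h) + g (x + s *\<^sub>R h) - (f x + g x)) / s"
        by (simp add: diff_divide_distrib add_divide_distrib)
      then have "ereal ((f (x + s *\<^sub>R h) - f x) / s + inner v h) \<le> ?Q (x, s)" by simp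
      also have "\<dots> \<le> C" using elim(1) by (rule less_imp_le)
      finally show ?case .
    qed
    have "((\<lambda>s. ereal ((f (x + s *\<^sub>R h) - f x) / s + inner v h)) \<longlongrightarrow> ereal (inner n h + inner v h)) (at_right 0)"
      by (intro tendsto_intros lim)
    then have "ereal (inner n h + inner v h) \<le> C"
      using ev by (rule tendsto_upperbound) simp
    then show False using C(2) by (simp add: inner_add_left)
  qed
qed

subsection \<open>Convergence of the safeguard sequence\<close>

text \<open>Only the static data of the proximal step and its line search; the accelerated sequences
  appear in the final theorem.\<close>

locale manpg =
  fixes M :: "'a::euclidean_space set" and f g :: "'a \<Rightarrow> real" and nf :: "'a \<Rightarrow> 'a"
    and R W :: "'a \<Rightarrow> 'a \<Rightarrow> 'a" and L \<kappa> \<kappa>' \<mu> \<sigma> \<nu> :: real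
  assumes M_compact: "compact M" and M_sub: "embedded_submanifold M"
    and R_smooth: "smooth_map_on {(u, \<xi>). u \<in> M \<and> \<xi> \<in> tangent_space M u} (\<lambda>(u, \<xi>). R u \<xi>)"
    and R_in: "\<And>u \<xi>. u \<in> M \<Longrightarrow> \<xi> \<in> tangent_space M u \<Longrightarrow> R u \<xi> \<in> M"
    and R_zero: "\<And>u. u \<in> M \<Longrightarrow> R u 0 = u"
    and R_deriv: "\<And>u \<xi>. u \<in> M \<Longrightarrow> \<xi> \<in> tangent_space M u \<Longrightarrow>
                    ((\<lambda>s. R u (s *\<^sub>R \<xi>)) has_vector_derivative \<xi>) (at 0)"
    and f_grad: "\<And>u. (f has_derivative (\<lambda>h. inner (nf u) h)) (at u)"
    and L_pos: "L > 0"
    and nf_lip: "\<And>u v. norm (nf u - nf v) \<le> L * norm (u - v)"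
    and g_cont: "continuous_on UNIV g" and g_convex: "convex_on UNIV g"
    and kappa: "0 < \<kappa>"
    and W_lin: "\<And>u a b \<xi> \<xi>'. u \<in> M \<Longrightarrow> \<xi> \<in> tangent_space M u \<Longrightarrow> \<xi>' \<in> tangent_space M u \<Longrightarrow>
                  W u (a *\<^sub>R \<xi> + b *\<^sub>R \<xi>') = a *\<^sub>R W u \<xi> + b *\<^sub>R W u \<xi>'"
    and W_maps: "\<And>u \<xi>. u \<in> M \<Longrightarrow> \<xi> \<in> tangent_space M u \<Longrightarrow> W u \<xi> \<in> tangent_space M u"
    and W_selfadj: "\<And>u \<xi> \<xi>'. u \<in> M \<Longrightarrow> \<xi> \<in> tangent_space M u \<Longrightarrow> \<xi>' \<in> tangent_space M u \<Longrightarrow>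
                  inner (W u \<xi>) \<xi>' = inner \<xi> (W u \<xi>')"
    and W_eig: "\<And>u \<xi> lam. u \<in> M \<Longrightarrow> \<xi> \<in> tangent_space M u \<Longrightarrow> \<xi> \<noteq> 0 \<Longrightarrow> W u \<xi> = lam *\<^sub>R \<xi> \<Longrightarrow>
                  \<kappa> \<le> lam \<and> lam \<le> \<kappa>'"
    and mu: "0 < \<mu>" and sigma: "0 < \<sigma>" "\<sigma> < \<kappa> / \<mu>" and nu: "0 < \<nu>" "\<nu> < 1"
begin

abbreviation "T \<equiv> tangent_space M"
abbreviation "\<eta> \<equiv> prox_dir M nf g W \<mu>"
abbreviation "F \<equiv> \<lambda>u. f u + g u"

lemmas T_subspace = subspace_tangent_space[OF M_sub]

lemma inner_rgrad: "u \<in> M \<Longrightarrow> \<xi> \<in> T u \<Longrightarrow> inner (rgrad M nf u) \<xi> = inner (nf u) \<xi>"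
  unfolding rgrad_def by (rule inner_proj_onto[OF T_subspace])

text \<open>\<open>W u\<close> is linear only on the tangent space; composed with the projection it
  becomes a linear map on the whole space, as the results on quadratic forms and on the subproblem
  require.\<close>

lemma W_proj:
  assumes u: "u \<in> M"
  defines "A \<equiv> \<lambda>\<xi>. W u (proj_onto (T u) \<xi>)"
  shows "linear A" "\<And>\<xi>. \<xi> \<in> T u \<Longrightarrow> A \<xi> = W u \<xi>"
proof -
  note P = proj_onto_in[OF T_subspace[OF u]] linear_proj_onto[OF T_subspace[OF u]]
  show "linear A"
  proof (rule linearI)
    show "A (v + w) = A v + A w" for v w
      using W_lin[OF u P(1) P(1), of 1 v 1 w] by (simp add: A_def linear_add[OF P(2)])
    show "A (c *\<^sub>R v) = c *\<^sub>R A v" for c v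
      using W_lin[OF u P(1) P(1), of c v 0 v] by (simp add: A_def linear_cmul[OF P(2)])
  qed
  show "A \<xi> = W u \<xi>" if "\<xi> \<in> T u" for \<xi>
    using that proj_onto_self[OF T_subspace[OF u]] by (simp add: A_def)
qed

lemma W_bounds:
  assumes u: "u \<in> M" and \<xi>: "\<xi> \<in> T u"
  shows "\<kappa> * (norm \<xi>)\<^sup>2 \<le> inner \<xi> (W u \<xi>)" "inner \<xi> (W u \<xi>) \<le> \<kappa>' * (norm \<xi>)\<^sup>2"
proof -
  let ?A = "\<lambda>\<xi>. W u (proj_onto (T u) \<xi>)"
  note A = W_proj[OF u]
  have 1: "?A \<xi> \<in> T u" if "\<xi> \<in> T u" for \<xi> using that A(2) W_maps[OF u] by simp
  have 2: "inner (?A \<xi>) \<xi>' = inner \<xi> (?A \<xi>')" if "\<xi> \<in> T u" "\<xi>' \<in> T u" for \<xi> \<xi>'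
    using that A(2) W_selfadj[OF u] by simp
  have 3: "\<kappa> \<le> lam \<and> lam \<le> \<kappa>'" if "\<xi> \<in> T u" "\<xi> \<noteq> 0" "?A \<xi> = lam *\<^sub>R \<xi>" for \<xi> lam
    using that A(2) W_eig[OF u] by simp
  show "\<kappa> * (norm \<xi>)\<^sup>2 \<le> inner \<xi> (W u \<xi>)"
    using quadratic_form_bounds(1)[OF T_subspace[OF u] A(1) 1 2 3 \<xi>] A(2)[OF \<xi>] by simp
  show "inner \<xi> (W u \<xi>) \<le> \<kappa>' * (norm \<xi>)\<^sup>2"
    using quadratic_form_bounds(2)[OF T_subspace[OF u] A(1) 1 2 3 \<xi>] A(2)[OF \<xi>] by simp
qed

lemma prox_model_at:
  assumes u: "u \<in> M"
  shows "prox_model (T u) (\<lambda>\<xi>. W u (proj_onto (T u) \<xi>)) g \<mu> \<kappa>"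
  using T_subspace[OF u] W_proj[OF u] W_bounds(1)[OF u] kappa mu g_cont g_convex
  by (intro prox_model.intro) simp_all

text \<open>\<open>prox_dir\<close> is a definite description, so it acquires its property only from
  existence and uniqueness of the minimiser.\<close>

lemma prox_dir_minimizer:
  assumes u: "u \<in> M"
  shows "\<eta> u \<in> T u"
    and "\<forall>\<xi>\<in>T u. prox_model.model (\<lambda>\<xi>. W u (proj_onto (T u) \<xi>)) g (rgrad M nf u) u \<mu> (\<eta> u)
      \<le> prox_model.model (\<lambda>\<xi>. W u (proj_onto (T u) \<xi>)) g (rgrad M nf u) u \<mu> \<xi>"
proof -
  interpret prox_model "T u" "\<lambda>\<xi>. W u (proj_onto (T u) \<xi>)" g "rgrad M nf u" u \<mu> \<kappa>
    by (rule prox_model_at[OF u])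
  have m: "model \<xi> = inner (rgrad M nf u) \<xi> + inner \<xi> (W u \<xi>) / (2 * \<mu>) + g (u + \<xi>)" if "\<xi> \<in> T u" for \<xi>
    using W_proj(2)[OF u that] by (simp add: model_def)
  let ?P = "\<lambda>\<eta>. \<eta> \<in> T u \<and> (\<forall>\<xi>\<in>T u. model \<eta> \<le> model \<xi>)"
  have "\<eta> u = (THE \<eta>. ?P \<eta>)"
    unfolding prox_dir_def by (rule arg_cong[where f = The]) (auto simp: m)
  moreover have "\<exists>!\<eta>. ?P \<eta>"
    using minimizer_exists minimizer_unique by blast
  then have "?P (THE \<eta>. ?P \<eta>)" by (rule theI')
  ultimately show "\<eta> u \<in> T u" "\<forall>\<xi>\<in>T u. model (\<eta> u) \<le> model \<xi>" by simp_all
qed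

lemma prox_dir_decrease:
  assumes u: "u \<in> M"
  shows "inner (nf u) (\<eta> u) + g (u + \<eta> u) - g u \<le> - (\<kappa> / \<mu>) * (norm (\<eta> u))\<^sup>2"
  using prox_model.minimizer_decrease[OF prox_model_at[OF u] prox_dir_minimizer[OF u]]
    inner_rgrad[OF u prox_dir_minimizer(1)[OF u]] by simp

text \<open>Dropping the nonnegative quadratic term at \<open>\<eta> u\<close> and bounding the one
  at \<open>\<xi>\<close> by \<kappa>' removes \<open>W\<close> from the inequality, which makes it
  fit for a passage to the limit.\<close>

lemma prox_dir_le:
  assumes u: "u \<in> M" and \<xi>: "\<xi> \<in> T u"
  shows "inner (nf u) (\<eta> u) + g (u + \<eta> u) \<le> inner (nf u) \<xi> + \<kappa>' / (2 * \<mu>) * (norm \<xi>)\<^sup>2 + g (u + \<xi>)"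
proof -
  interpret prox_model "T u" "\<lambda>\<xi>. W u (proj_onto (T u) \<xi>)" g "rgrad M nf u" u \<mu> \<kappa>
    by (rule prox_model_at[OF u])
  note \<eta> = prox_dir_minimizer[OF u]
  have "model (\<eta> u) \<le> model \<xi>" using \<eta> \<xi> by blast
  moreover have "0 \<le> inner (\<eta> u) (W u (\<eta> u)) / (2 * \<mu>)"
    using order_trans[OF _ W_bounds(1)[OF u \<eta>(1)]] kappa mu by simp
  moreover have "inner \<xi> (W u \<xi>) / (2 * \<mu>) \<le> \<kappa>' * (norm \<xi>)\<^sup>2 / (2 * \<mu>)"
    using W_bounds(2)[OF u \<xi>] mu by (intro divide_right_mono) auto
  ultimately show ?thesis
    using W_proj(2)[OF u \<xi>] W_proj(2)[OF u \<eta>(1)] inner_rgrad[OF u \<xi>] inner_rgrad[OF u \<eta>(1)]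
    by (simp add: model_def)
qed

section \<open>Bounds uniform over the compact manifold\<close>

lemma g_bounded_on_ball: "\<exists>K. \<forall>w\<in>cball 0 r. \<bar>g w\<bar> \<le> K"
proof -
  have "compact (g ` cball 0 r)"
    by (intro compact_continuous_image continuous_on_subset[OF g_cont]) auto
  from compact_imp_bounded[OF this] show ?thesis by (auto simp: bounded_iff)
qed

lemma nf_continuous: "continuous_on S nf"
proof -
  have "L-lipschitz_on UNIV nf"
    using nf_lip L_pos by (intro lipschitz_onI) (auto simp: dist_norm)
  then show ?thesis using lipschitz_on_continuous_on continuous_on_subset by blast
qed

lemma nf_bounded: "\<exists>G. \<forall>u\<in>M. norm (nf u) \<le> G"
proof -
  have "compact (nf ` M)" by (intro compact_continuous_image nf_continuous M_compact)
  from compact_imp_bounded[OF this] show ?thesis by (auto simp: bounded_iff)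
qed

lemma M_bounded: "\<exists>\<rho>. \<forall>u\<in>M. norm u \<le> \<rho>"
  using compact_imp_bounded[OF M_compact] by (auto simp: bounded_iff)

text \<open>\<open>sublevel_bound\<close> applies with the same constants everywhere:
  \<open>K\<close> bounds \<open>g\<close> on all unit balls centred in \<open>M\<close>, and
  projection does not lengthen the gradient, so \<open>G\<close> bounds \<open>rgrad\<close>
  too.\<close>

lemma prox_dir_bounded: "\<exists>B>0. \<forall>u\<in>M. norm (\<eta> u) \<le> B"
proof -
  obtain \<rho> where \<rho>: "\<And>u. u \<in> M \<Longrightarrow> norm u \<le> \<rho>" using M_bounded by blast
  obtain K where K: "\<And>w. w \<in> cball 0 (\<rho> + 1) \<Longrightarrow> \<bar>g w\<bar> \<le> K" using g_bounded_on_ball by blast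
  obtain G where G: "\<And>u. u \<in> M \<Longrightarrow> norm (nf u) \<le> G" using nf_bounded by blast
  let ?B = "1 + 2 * \<mu> * (G + 2 * K) / \<kappa>"
  have "norm (\<eta> u) \<le> ?B" if u: "u \<in> M" for u
  proof -
    interpret prox_model "T u" "\<lambda>\<xi>. W u (proj_onto (T u) \<xi>)" g "rgrad M nf u" u \<mu> \<kappa>
      by (rule prox_model_at[OF u])
    have Ku: "\<bar>g w\<bar> \<le> K" if "w \<in> cball u 1" for w
    proof (rule K)
      have "norm w \<le> norm u + dist u w" using norm_triangle_ineq2[of w u] by (simp add: dist_norm norm_minus_commute)
      then show "w \<in> cball 0 (\<rho> + 1)" using that \<rho>[OF u] by simp
    qed
    have "norm (rgrad M nf u) \<le> norm (nf u)"
    proof -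
      let ?r = "rgrad M nf u"
      have "?r \<in> T u" unfolding rgrad_def by (rule proj_onto_in[OF T_subspace[OF u]])
      then have "norm ?r * norm ?r = inner (nf u) ?r"
        using inner_rgrad[OF u, of ?r] by (simp add: power2_norm_eq_inner flip: power2_eq_square)
      also have "\<dots> \<le> norm (nf u) * norm ?r" by (rule norm_cauchy_schwarz)
      finally show ?thesis by (cases "?r = 0") auto
    qed
    then have "norm (rgrad M nf u) \<le> G" using G[OF u] by linarith
    moreover have "norm (\<eta> u) \<le> 1 + 2 * \<mu> * (norm (rgrad M nf u) + 2 * K) / \<kappa>"
      using prox_dir_minimizer[OF u] subspace_0[OF T_subspace[OF u]] model_0
      by (intro sublevel_bound Ku) force+
    moreover have "2 * \<mu> * (norm (rgrad M nf u) + 2 * K) / \<kappa> \<le> 2 * \<mu> * (G + 2 * K) / \<kappa>"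
      using calculation(1) mu kappa by (intro divide_right_mono mult_left_mono) auto
    ultimately show ?thesis by linarith
  qed
  then show ?thesis
    by (intro exI[of _ "max 1 ?B"]) (auto intro: order_trans[OF _ max.cobounded2])
qed

text \<open>The retraction error is of order e \<alpha> |\<eta>| while the guaranteed decrease is of
  order \<alpha> |\<eta>|^2, so the tolerance \<open>e\<close> must be proportional to a lower bound
  \<open>c\<close> on the direction. With \<open>c\<close> fixed, all constants are uniform near
  \<open>x\<close>.\<close>

lemma armijo_condition_near:
  assumes x: "x \<in> M" and c: "c > 0"
  obtains d where "d > 0" "\<And>u \<alpha>. u \<in> M \<Longrightarrow> norm (u - x) < d \<Longrightarrow> c \<le> norm (\<eta> u) \<Longrightarrow> 0 < \<alpha> \<Longrightarrow> \<alpha> < d \<Longrightarrow>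
    F (R u (\<alpha> *\<^sub>R \<eta> u)) \<le> F u - \<sigma> * \<alpha> * (norm (\<eta> u))\<^sup>2"
proof -
  obtain \<rho> where \<rho>: "\<And>u. u \<in> M \<Longrightarrow> norm u \<le> \<rho>" using M_bounded by blast
  obtain B where B: "B > 0" "\<And>u. u \<in> M \<Longrightarrow> norm (\<eta> u) \<le> B" using prox_dir_bounded by blast
  \<comment> \<open>The ball of radius \<rho> + B contains the retracted points and the straight
    steps; one unit more is needed for the Lipschitz bound, whose constant is
    \<open>2 * K\<close>.\<close>
  obtain K where K: "\<And>w. w \<in> cball 0 ((\<rho> + B) + 1) \<Longrightarrow> \<bar>g w\<bar> \<le> K" using g_bounded_on_ball by blast
  obtain G where G: "\<And>u. u \<in> M \<Longrightarrow> norm (nf u) \<le> G" using nf_bounded by blast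
  have "0 \<le> \<rho>" using order_trans[OF norm_ge_zero \<rho>[OF x]] .
  then have K0: "0 \<le> K" using order_trans[OF abs_ge_zero K[of 0]] B(1) by simp
  have G0: "0 \<le> G" using order_trans[OF norm_ge_zero G[OF x]] .
  \<comment> \<open>Half of the surplus \<kappa> / \<mu> - \<sigma>, available once for the
    retraction error and once for the remainder of \<open>f\<close>.\<close>
  define \<gamma> where "\<gamma> = (\<kappa> / \<mu> - \<sigma>) / 2"
  have \<gamma>: "\<gamma> > 0" using sigma by (simp add: \<gamma>_def)
  define e where "e = min 1 (\<gamma> * c / (G + 2 * K + 1))"
  have GK: "G + 2 * K + 1 > 0" using G0 K0 by linarith
  have e: "0 < e" "e \<le> 1" using \<gamma> c GK by (auto simp: e_def)
  have "(G + 2 * K) * e \<le> (G + 2 * K + 1) * (\<gamma> * c / (G + 2 * K + 1))"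
    using e G0 K0 by (intro mult_mono) (auto simp: e_def)
  then have eGK: "(G + 2 * K) * e \<le> \<gamma> * c" using GK by simp
  obtain d0 where d0: "d0 > 0" "\<And>u \<xi>. u \<in> M \<Longrightarrow> norm (u - x) < d0 \<Longrightarrow> \<xi> \<in> T u \<Longrightarrow>
    norm \<xi> < d0 \<Longrightarrow> norm (R u \<xi> - u - \<xi>) \<le> e * norm \<xi>"
    using retraction_first_order[OF M_sub R_smooth R_zero R_deriv x e(1)] by blast
  \<comment> \<open>In turn: \<alpha> at most 1, \<open>u\<close> in the range of the retraction
    estimate, \<open>\<alpha> *\<^sub>R \<eta> u\<close> in it as well, and 4 L \<alpha> at most
    \<gamma>.\<close>
  define d where "d = min (min 1 d0) (min (d0 / B) (\<gamma> / (4 * L)))"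
  have d: "d > 0" "d \<le> 1" "d \<le> d0" "d * B \<le> d0" "4 * L * d \<le> \<gamma>"
  proof -
    show "d > 0" using d0 B L_pos \<gamma> by (simp add: d_def)
    show "d \<le> 1" "d \<le> d0" by (auto simp: d_def)
    have "d \<le> d0 / B" "d \<le> \<gamma> / (4 * L)" by (auto simp: d_def)
    then show "d * B \<le> d0" "4 * L * d \<le> \<gamma>" using B L_pos by (auto simp: field_simps)
  qed
  show ?thesis
  proof (rule that[OF d(1)])
    fix u \<alpha> assume u: "u \<in> M" "norm (u - x) < d" and cu: "c \<le> norm (\<eta> u)" and \<alpha>: "0 < \<alpha>" "\<alpha> < d"
    have \<alpha>\<eta>: "\<alpha> *\<^sub>R \<eta> u \<in> T u" using T_subspace u(1) prox_dir_minimizer(1) by (simp add: subspace_scale)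
    have n\<alpha>: "norm (\<alpha> *\<^sub>R \<eta> u) < d0"
    proof -
      have "norm (\<alpha> *\<^sub>R \<eta> u) \<le> \<alpha> * B" using B(2)[OF u(1)] \<alpha> by simp
      also have "\<dots> < d * B" using \<alpha> B by simp
      finally show ?thesis using d by simp
    qed
    have y: "norm (R u (\<alpha> *\<^sub>R \<eta> u) - u - \<alpha> *\<^sub>R \<eta> u) \<le> e * norm (\<alpha> *\<^sub>R \<eta> u)"
      using u d \<alpha>\<eta> n\<alpha> by (intro d0) auto
    have yM: "R u (\<alpha> *\<^sub>R \<eta> u) \<in> M" using R_in u(1) \<alpha>\<eta> by blast
    have glip: "\<bar>g (R u (\<alpha> *\<^sub>R \<eta> u)) - g (u + \<alpha> *\<^sub>R \<eta> u)\<bar> \<le> 2 * K * norm (R u (\<alpha> *\<^sub>R \<eta> u) - (u + \<alpha> *\<^sub>R \<eta> u))"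
    proof (rule convex_on_lipschitz_cball[OF g_convex K])
      show "R u (\<alpha> *\<^sub>R \<eta> u) \<in> cball 0 (\<rho> + B)" using \<rho>[OF yM] B by simp
      have "norm (u + \<alpha> *\<^sub>R \<eta> u) \<le> norm u + norm (\<alpha> *\<^sub>R \<eta> u)" by (rule norm_triangle_ineq)
      also have "norm (\<alpha> *\<^sub>R \<eta> u) \<le> 1 * norm (\<eta> u)"
        using \<alpha> d by (simp add: mult_left_le_one_le)
      finally show "u + \<alpha> *\<^sub>R \<eta> u \<in> cball 0 (\<rho> + B)" using \<rho>[OF u(1)] B(2)[OF u(1)] by simp
    qed
    show "F (R u (\<alpha> *\<^sub>R \<eta> u)) \<le> F u - \<sigma> * \<alpha> * (norm (\<eta> u))\<^sup>2"
    proof (rule approximate_step_sufficient_decrease[OF f_grad nf_lip _ g_convex glip _ G[OF u(1)]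
          _ _ _ _ y prox_dir_decrease[OF u(1)]])
      have "(G + 2 * K) * e \<le> \<gamma> * norm (\<eta> u)"
        using eGK cu \<gamma> by (meson mult_left_mono order_trans less_imp_le)
      then show "(G + 2 * K) * e \<le> (\<kappa> / \<mu> - \<sigma>) / 2 * norm (\<eta> u)" by (simp add: \<gamma>_def)
      have "4 * L * \<alpha> \<le> 4 * L * d" using \<alpha> L_pos by simp
      then show "4 * L * \<alpha> \<le> (\<kappa> / \<mu> - \<sigma>) / 2" using d by (simp add: \<gamma>_def)
    qed (use \<alpha> d e K0 L_pos in auto)
  qed
qed

section \<open>Backtracking step lengths and the limit of the directions\<close>

abbreviation step :: "'a \<Rightarrow> real" where
  "step u \<equiv> armijo_alpha F R \<sigma> \<nu> u (\<eta> u)"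

text \<open>Backtracking ends because \<open>armijo_condition_near\<close>, with \<open>u\<close> as
  centre and the length of its own direction as \<open>c\<close>, accepts all small steps; a zero
  direction leaves \<open>u\<close> fixed and is accepted at once.\<close>

lemma armijo_holds:
  assumes u: "u \<in> M"
  shows "0 < step u" "F (R u (step u *\<^sub>R \<eta> u)) \<le> F u - \<sigma> * step u * (norm (\<eta> u))\<^sup>2"
proof -
  let ?P = "\<lambda>j. F (R u (\<nu> ^ j *\<^sub>R \<eta> u)) \<le> F u - \<sigma> * \<nu> ^ j * (norm (\<eta> u))\<^sup>2"
  have "\<exists>j. ?P j"
  proof (cases "\<eta> u = 0")
    case True
    then show ?thesis using R_zero[OF u] by simp
  next
    case False
    then obtain d where d: "d > 0" "\<And>v \<alpha>. v \<in> M \<Longrightarrow> norm (v - u) < d \<Longrightarrow> norm (\<eta> u) \<le> norm (\<eta> v) \<Longrightarrow>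
      0 < \<alpha> \<Longrightarrow> \<alpha> < d \<Longrightarrow> F (R v (\<alpha> *\<^sub>R \<eta> v)) \<le> F v - \<sigma> * \<alpha> * (norm (\<eta> v))\<^sup>2"
      using armijo_condition_near[OF u, of "norm (\<eta> u)"] by auto
    obtain j where "\<nu> ^ j < d" using real_arch_pow_inv[OF d(1) nu(2)] by blast
    then show ?thesis using d u nu by (intro exI[of _ j] d(2)) auto
  qed
  then have "?P (LEAST j. ?P j)" by (rule LeastI_ex)
  then show "F (R u (step u *\<^sub>R \<eta> u)) \<le> F u - \<sigma> * step u * (norm (\<eta> u))\<^sup>2"
    by (simp add: armijo_alpha_def)
  show "0 < step u" using nu by (simp add: armijo_alpha_def)
qed

text \<open>The trial before the accepted one failed and so was at least \<open>d\<close>; one more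
  factor \<nu> gives the bound. The value 1 covers acceptance of the first trial.\<close>

lemma step_lower_bound:
  assumes d: "\<And>\<alpha>. 0 < \<alpha> \<Longrightarrow> \<alpha> < d \<Longrightarrow> F (R u (\<alpha> *\<^sub>R \<eta> u)) \<le> F u - \<sigma> * \<alpha> * (norm (\<eta> u))\<^sup>2"
  shows "min 1 (\<nu> * d) \<le> step u"
proof -
  let ?P = "\<lambda>j. F (R u (\<nu> ^ j *\<^sub>R \<eta> u)) \<le> F u - \<sigma> * \<nu> ^ j * (norm (\<eta> u))\<^sup>2"
  show ?thesis
  proof (cases "LEAST j. ?P j")
    case 0
    then show ?thesis by (simp add: armijo_alpha_def)
  next
    case (Suc j)
    then have "\<not> ?P j" using not_less_Least[of j ?P] by simp
    then have "d \<le> \<nu> ^ j" using d[of "\<nu> ^ j"] nu by force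
    then have "\<nu> * d \<le> step u" using Suc nu by (simp add: armijo_alpha_def)
    then show ?thesis by simp
  qed
qed

text \<open>Near \<open>x\<close>, a direction of length at least \<open>c\<close> comes with a step
  of at least \<open>b\<close>; the product would then be at least b c^2, which \<open>lim\<close>
  eventually excludes.\<close>

lemma prox_dir_tendsto_0:
  assumes Z: "\<And>n. Z n \<in> M" "Z \<longlonglongrightarrow> x" "x \<in> M"
    and lim: "(\<lambda>n. step (Z n) * (norm (\<eta> (Z n)))\<^sup>2) \<longlonglongrightarrow> 0"
  shows "(\<lambda>n. \<eta> (Z n)) \<longlonglongrightarrow> 0"
proof (rule tendsto_norm_zero_cancel, rule order_tendstoI)
  show "eventually (\<lambda>n. a < norm (\<eta> (Z n))) sequentially" if "a < 0" for a
    by (intro always_eventually allI less_le_trans[OF that norm_ge_zero])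
next
  fix c :: real assume c: "0 < c"
  obtain d where d: "d > 0" "\<And>u \<alpha>. u \<in> M \<Longrightarrow> norm (u - x) < d \<Longrightarrow> c \<le> norm (\<eta> u) \<Longrightarrow> 0 < \<alpha> \<Longrightarrow> \<alpha> < d \<Longrightarrow>
    F (R u (\<alpha> *\<^sub>R \<eta> u)) \<le> F u - \<sigma> * \<alpha> * (norm (\<eta> u))\<^sup>2"
    using armijo_condition_near[OF Z(3) c] by blast
  define b where "b = min 1 (\<nu> * d)"
  have b: "b > 0" using d(1) nu by (simp add: b_def)
  have "eventually (\<lambda>n. norm (Z n - x) < d) sequentially"
    using tendstoD[OF Z(2) d(1)] by (simp add: dist_norm)
  moreover have "eventually (\<lambda>n. step (Z n) * (norm (\<eta> (Z n)))\<^sup>2 < b * c\<^sup>2) sequentially"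
    using order_tendstoD(2)[OF lim] b c by simp
  ultimately show "eventually (\<lambda>n. norm (\<eta> (Z n)) < c) sequentially"
  proof eventually_elim
    case (elim n)
    show ?case
    proof (rule ccontr)
      assume "\<not> norm (\<eta> (Z n)) < c"
      then have cn: "c \<le> norm (\<eta> (Z n))" by simp
      have "b \<le> step (Z n)"
        unfolding b_def by (rule step_lower_bound) (rule d(2)[OF Z(1) elim(1) cn])
      then have "b * c\<^sup>2 \<le> step (Z n) * (norm (\<eta> (Z n)))\<^sup>2"
        using cn b c by (intro mult_mono power_mono) auto
      then show False using elim(2) by simp
    qed
  qed
qed

lemma stationary_limit:
  assumes Z: "\<And>n. Z n \<in> M" "Z \<longlonglongrightarrow> x" "x \<in> M" and lim: "(\<lambda>n. \<eta> (Z n)) \<longlonglongrightarrow> 0"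
  shows "0 \<in> proj_onto (T x) ` clarke_subdiff F x"
proof -
  have gc: "(\<lambda>n. g (X n)) \<longlonglongrightarrow> g w" if "X \<longlonglongrightarrow> w" for X w
    using continuous_on_tendsto_compose[OF g_cont that] by simp
  have nfc: "(\<lambda>n. nf (Z n)) \<longlonglongrightarrow> nf x"
    using continuous_on_tendsto_compose[OF nf_continuous[of UNIV] Z(2)] by simp
  have quad: "g x \<le> inner (nf x) \<xi> + \<kappa>' / (2 * \<mu>) * (norm \<xi>)\<^sup>2 + g (x + \<xi>)" if \<xi>: "\<xi> \<in> T x" for \<xi>
  proof -
    obtain \<Xi> where \<Xi>: "\<And>n. \<Xi> n \<in> T (Z n)" "\<Xi> \<longlonglongrightarrow> \<xi>"
      using tangent_space_lower_semicontinuous[OF M_sub Z \<xi>] by blast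
    have "(\<lambda>n. inner (nf (Z n)) (\<eta> (Z n)) + g (Z n + \<eta> (Z n))) \<longlonglongrightarrow> inner (nf x) 0 + g (x + 0)"
      by (intro tendsto_intros gc nfc lim Z)
    moreover have "(\<lambda>n. inner (nf (Z n)) (\<Xi> n) + \<kappa>' / (2 * \<mu>) * (norm (\<Xi> n))\<^sup>2 + g (Z n + \<Xi> n))
        \<longlonglongrightarrow> inner (nf x) \<xi> + \<kappa>' / (2 * \<mu>) * (norm \<xi>)\<^sup>2 + g (x + \<xi>)"
      by (intro tendsto_intros gc nfc \<Xi> Z)
    ultimately have "inner (nf x) 0 + g (x + 0) \<le> inner (nf x) \<xi> + \<kappa>' / (2 * \<mu>) * (norm \<xi>)\<^sup>2 + g (x + \<xi>)"
      by (rule LIMSEQ_le) (use prox_dir_le[OF Z(1) \<Xi>(1)] in blast)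
    then show ?thesis by simp
  qed
  have opt: "g x \<le> inner (nf x) \<xi> + g (x + \<xi>)" if \<xi>: "\<xi> \<in> T x" for \<xi>
  proof -
    define C where "C = \<kappa>' / (2 * \<mu>) * (norm \<xi>)\<^sup>2"
    \<comment> \<open>At \<open>s *\<^sub>R \<xi>\<close> the quadratic term is s^2 C; after
      convexity of \<open>g\<close> and division by s there remains s C, which vanishes as s tends
      to 0.\<close>
    have "g x \<le> inner (nf x) \<xi> + s * C + g (x + \<xi>)" if s: "0 < s" "s < 1" for s
    proof -
      have "g x \<le> s * inner (nf x) \<xi> + s * (s * C) + g (x + s *\<^sub>R \<xi>)"
        using quad[of "s *\<^sub>R \<xi>"] \<xi> T_subspace[OF Z(3)]
        by (simp add: subspace_scale C_def power_mult_distrib power2_eq_square mult_ac)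
      also have "g (x + s *\<^sub>R \<xi>) \<le> (1 - s) * g x + s * g (x + \<xi>)"
        using s by (intro convex_on_segment_le g_convex) auto
      finally have "s * g x \<le> s * (inner (nf x) \<xi> + s * C + g (x + \<xi>))"
        by (simp add: algebra_simps)
      then show ?thesis using s by simp
    qed
    then have ev: "eventually (\<lambda>s. g x \<le> inner (nf x) \<xi> + s * C + g (x + \<xi>)) (at_right 0)"
      using eventually_at_right_real[of 0 1] by (auto elim: eventually_mono)
    have "((\<lambda>s. inner (nf x) \<xi> + s * C + g (x + \<xi>)) \<longlongrightarrow> inner (nf x) \<xi> + 0 * C + g (x + \<xi>)) (at_right 0)"
      by (intro tendsto_intros)
    from tendsto_lowerbound[OF this ev] show ?thesis by simp
  qed
  obtain v where v: "\<And>y. g x + inner v (y - x) \<le> g y" "\<And>\<xi>. \<xi> \<in> T x \<Longrightarrow> inner (nf x + v) \<xi> = 0"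
    using convex_subgradient_normal_to_subspace[OF g_convex T_subspace[OF Z(3)] opt] by blast
  have "nf x + v \<in> clarke_subdiff F x"
    by (rule gradient_plus_subgradient_in_clarke_subdiff[OF f_grad v(1)])
  moreover have "proj_onto (T x) (nf x + v) = 0"
    using v(2) subspace_0[OF T_subspace[OF Z(3)]] by (intro proj_onto_eqI T_subspace Z(3)) auto
  ultimately show ?thesis by (metis image_eqI)
qed

lemma F_bounded_below: "\<exists>m. \<forall>u\<in>M. m \<le> F u"
proof -
  have "continuous_on M f"
    using f_grad has_derivative_continuous by (metis continuous_at_imp_continuous_on)
  then have "compact (F ` M)"
    by (intro compact_continuous_image continuous_intros M_compact continuous_on_subset[OF g_cont]) auto
  from compact_imp_bounded[OF this] have "bdd_below (F ` M)" by (rule bounded_imp_bdd_below)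
  then show ?thesis by (auto simp: bdd_below_def)
qed

text \<open>\<open>dec\<close> is an inequality because the safeguard may keep a better iterate than
  the Armijo point. The values of \<open>F\<close> decrease and are bounded below on
  \<open>M\<close>, so consecutive differences vanish along the whole sequence, and only afterwards
  is the subsequence taken.\<close>

lemma accumulation_point_stationary:
  assumes Z: "\<And>n. Z n \<in> M" and dec: "\<And>n. F (Z (Suc n)) \<le> F (R (Z n) (step (Z n) *\<^sub>R \<eta> (Z n)))"
    and r: "strict_mono r" "(\<lambda>i. Z (r i)) \<longlonglongrightarrow> x"
  shows "0 \<in> proj_onto (T x) ` clarke_subdiff F x"
proof -
  let ?s = "\<lambda>n. step (Z n) * (norm (\<eta> (Z n)))\<^sup>2"
  have d: "F (Z (Suc n)) \<le> F (Z n) - \<sigma> * ?s n" for n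
    using dec[of n] armijo_holds(2)[OF Z[of n]] by (simp add: mult.assoc)
  have s0: "0 \<le> ?s n" for n using armijo_holds(1)[OF Z[of n]] by simp
  have "decseq (\<lambda>n. F (Z n))"
  proof (rule decseq_SucI)
    fix n
    have "0 \<le> \<sigma> * ?s n" by (rule mult_nonneg_nonneg[OF less_imp_le[OF sigma(1)] s0])
    then show "F (Z (Suc n)) \<le> F (Z n)" using d[of n] by linarith
  qed
  moreover obtain m where "\<forall>n. m \<le> F (Z n)" using F_bounded_below Z by blast
  ultimately obtain l where l: "(\<lambda>n. F (Z n)) \<longlonglongrightarrow> l"
    by (rule decseq_convergent)
  have "(\<lambda>n. (F (Z n) - F (Z (Suc n))) / \<sigma>) \<longlonglongrightarrow> (l - l) / \<sigma>"
    using l sigma by (intro tendsto_intros LIMSEQ_Suc) auto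
  then have "(\<lambda>n. (F (Z n) - F (Z (Suc n))) / \<sigma>) \<longlonglongrightarrow> 0" by simp
  then have "?s \<longlonglongrightarrow> 0"
  proof (rule Lim_null_comparison[rotated])
    show "eventually (\<lambda>n. norm (?s n) \<le> (F (Z n) - F (Z (Suc n))) / \<sigma>) sequentially"
    proof (rule always_eventually, rule allI)
      fix n
      have "?s n * \<sigma> \<le> F (Z n) - F (Z (Suc n))" using d[of n] by (simp add: algebra_simps)
      then have "?s n \<le> (F (Z n) - F (Z (Suc n))) / \<sigma>" using sigma by (simp only: pos_le_divide_eq)
      then show "norm (?s n) \<le> (F (Z n) - F (Z (Suc n))) / \<sigma>" using s0[of n] by simp
    qed
  qed
  from LIMSEQ_subseq_LIMSEQ[OF this r(1)]
  have lim: "(\<lambda>i. ?s (r i)) \<longlonglongrightarrow> 0" by (simp add: o_def)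
  have x: "x \<in> M" using closed_sequentially[OF compact_imp_closed[OF M_compact] _ r(2)] Z by blast
  show ?thesis
    by (rule stationary_limit[OF Z r(2) x]) (rule prox_dir_tendsto_0[OF Z r(2) x lim])
qed

end

text \<open>\<open>xb\<close>, \<open>yb\<close>, \<open>tb\<close> hold the values computed in (b),
  while \<open>x\<close>, \<open>y\<close>, \<open>t\<close> are those after the safeguard (a) at
  the same index has possibly replaced them. The inverse retraction is expressed by a tangent vector
  \<open>\<zeta> k\<close> that the retraction at \<open>xb (Suc k)\<close> sends to
  \<open>x k\<close>.\<close>

theorem theorem1:
  fixes M :: "(real^'p^'n) set"
    and f g :: "real^'p^'n \<Rightarrow> real"
    and nf :: "real^'p^'n \<Rightarrow> real^'p^'n"
    and R :: "real^'p^'n \<Rightarrow> real^'p^'n \<Rightarrow> real^'p^'n"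
    and W :: "real^'p^'n \<Rightarrow> real^'p^'n \<Rightarrow> real^'p^'n"
    and L \<kappa> \<kappa>' \<mu> \<sigma> \<nu> :: real and N :: nat
    and x0 :: "real^'p^'n"
    and x y xb yb z \<zeta> :: "nat \<Rightarrow> real^'p^'n"
    and t tb :: "nat \<Rightarrow> real"
  defines "F \<equiv> (\<lambda>u. f u + g u)"
  defines "T \<equiv> tangent_space M"
  defines "\<eta> \<equiv> prox_dir M nf g W \<mu>"
  assumes M_compact: "compact M" and M_sub: "embedded_submanifold M"
    and R_smooth: "smooth_map_on {(u, \<xi>). u \<in> M \<and> \<xi> \<in> T u} (\<lambda>(u, \<xi>). R u \<xi>)"
    and R_in: "\<And>u \<xi>. u \<in> M \<Longrightarrow> \<xi> \<in> T u \<Longrightarrow> R u \<xi> \<in> M"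
    and R_zero: "\<And>u. u \<in> M \<Longrightarrow> R u 0 = u"
    and R_deriv: "\<And>u \<xi>. u \<in> M \<Longrightarrow> \<xi> \<in> T u \<Longrightarrow>
                    ((\<lambda>s. R u (s *\<^sub>R \<xi>)) has_vector_derivative \<xi>) (at 0)"
    and f_grad: "\<And>u. (f has_derivative (\<lambda>h. inner (nf u) h)) (at u)"
    and L_pos: "L > 0"
    and nf_lip: "\<And>u v. norm (nf u - nf v) \<le> L * norm (u - v)"
    and g_cont: "continuous_on UNIV g" and g_convex: "convex_on UNIV g"
    and F_coercive: "filterlim F at_top at_infinity"
    and kappa: "0 < \<kappa>" "\<kappa> \<le> \<kappa>'"
    and W_lin: "\<And>u a b \<xi> \<xi>'. u \<in> M \<Longrightarrow> \<xi> \<in> T u \<Longrightarrow> \<xi>' \<in> T u \<Longrightarrow>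
                  W u (a *\<^sub>R \<xi> + b *\<^sub>R \<xi>') = a *\<^sub>R W u \<xi> + b *\<^sub>R W u \<xi>'"
    and W_maps: "\<And>u \<xi>. u \<in> M \<Longrightarrow> \<xi> \<in> T u \<Longrightarrow> W u \<xi> \<in> T u"
    and W_selfadj: "\<And>u \<xi> \<xi>'. u \<in> M \<Longrightarrow> \<xi> \<in> T u \<Longrightarrow> \<xi>' \<in> T u \<Longrightarrow>
                  inner (W u \<xi>) \<xi>' = inner \<xi> (W u \<xi>')"
    and W_posdef: "\<And>u \<xi>. u \<in> M \<Longrightarrow> \<xi> \<in> T u \<Longrightarrow> \<xi> \<noteq> 0 \<Longrightarrow> inner \<xi> (W u \<xi>) > 0"
    and W_eig: "\<And>u \<xi> lam. u \<in> M \<Longrightarrow> \<xi> \<in> T u \<Longrightarrow> \<xi> \<noteq> 0 \<Longrightarrow> W u \<xi> = lam *\<^sub>R \<xi> \<Longrightarrow>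
                  \<kappa> \<le> lam \<and> lam \<le> \<kappa>'"
    and mu: "0 < \<mu>" "\<mu> \<le> 1 / L"
    and sigma: "0 < \<sigma>" "\<sigma> < 1" "\<sigma> < \<kappa> / \<mu>"
    and nu: "0 < \<nu>" "\<nu> < 1"
    and N_pos: "0 < N"
    and x0_in: "x0 \<in> M"
    and init: "xb 0 = x0" "yb 0 = x0" "tb 0 = 1" "z 0 = x0"
    and step_b: "\<And>k. xb (Suc k) = R (y k) (\<eta> (y k))
                   \<and> tb (Suc k) = (sqrt (4 * (t k)\<^sup>2 + 1) + 1) / 2
                   \<and> \<zeta> k \<in> T (xb (Suc k)) \<and> R (xb (Suc k)) (\<zeta> k) = x k
                   \<and> yb (Suc k) = R (xb (Suc k)) (((1 - t k) / tb (Suc k)) *\<^sub>R \<zeta> k)"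
    and no_safeguard: "\<And>k. \<not> N dvd k \<Longrightarrow> x k = xb k \<and> y k = yb k \<and> t k = tb k"
    and safeguard: "\<And>k. N dvd k \<Longrightarrow>
        (let w = R (z k) (armijo_alpha F R \<sigma> \<nu> (z k) (\<eta> (z k)) *\<^sub>R \<eta> (z k)) in
          (if F w < F (xb k) then x k = w \<and> y k = w \<and> t k = 1
           else x k = xb k \<and> y k = yb k \<and> t k = tb k)
          \<and> z (k + N) = x k)"
  shows "\<forall>zs. (\<exists>r. strict_mono r \<and> ((\<lambda>i. z (r i * N)) \<longlonglongrightarrow> zs)) \<longrightarrow>
           0 \<in> proj_onto (T zs) ` clarke_subdiff F zs"
proof -
  interpret A: manpg M f g nf R W L \<kappa> \<kappa>' \<mu> \<sigma> \<nu>
    by (unfold_locales; (fact assms[unfolded T_def])?)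
  define w where "w = (\<lambda>k. R (z k) (armijo_alpha F R \<sigma> \<nu> (z k) (\<eta> (z k)) *\<^sub>R \<eta> (z k)))"
  \<comment> \<open>In the branch that keeps \<open>xb k\<close>, the failed test itself gives F (w
    k) \<ge> F (xb k), so the kept point is never worse than the Armijo point.\<close>
  have sg: "F (x k) \<le> F (w k)" "z (k + N) = x k"
    "(x k = w k \<and> y k = w k) \<or> (x k = xb k \<and> y k = yb k)" if "N dvd k" for k
    using safeguard[OF that] by (auto simp: Let_def w_def split: if_splits)
  have dir: "c *\<^sub>R \<eta> u \<in> T u" if "u \<in> M" for u c
    using A.prox_dir_minimizer(1)[OF that] A.T_subspace[OF that]
    by (simp add: T_def \<eta>_def subspace_scale)
  have wM: "w k \<in> M" if "z k \<in> M" for k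
    unfolding w_def using R_in[OF that] dir[OF that] by blast
  have step_M: "x k \<in> M \<and> y k \<in> M" if "xb k \<in> M" "yb k \<in> M" "N dvd k \<Longrightarrow> z k \<in> M" for k
    using no_safeguard[of k] sg(3)[of k] wM[of k] that by (cases "N dvd k") auto
  \<comment> \<open>Strong induction, because \<open>z k\<close> is obtained from index k - N while
    \<open>xb k\<close> and \<open>yb k\<close> come from the previous index.\<close>
  have inM: "xb k \<in> M \<and> yb k \<in> M \<and> (N dvd k \<longrightarrow> z k \<in> M)" for k
  proof (induction k rule: less_induct)
    case (less k)
    have z: "z k \<in> M" if dv: "N dvd k"
    proof (cases "k = 0")
      case False
      with dv have "N \<le> k" using dvd_imp_le by blast
      then obtain j where j: "k = j + N" using le_Suc_ex by (metis add.commute)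
      then have "N dvd j" "j < k" using dv N_pos by (auto simp: dvd_add_left_iff)
      then show ?thesis using sg(2)[of j] step_M[of j] less.IH[of j] j by simp
    qed (use init x0_in in simp)
    show ?case
    proof (cases k)
      case 0
      then show ?thesis using init x0_in by simp
    next
      case (Suc j)
      then have xy: "x j \<in> M" "y j \<in> M" using step_M[of j] less.IH[of j] by auto
      have xb: "xb (Suc j) \<in> M" using step_b[of j] R_in[OF xy(2)] dir[OF xy(2), of 1] by simp
      moreover have "\<zeta> j \<in> T (xb (Suc j))"
        and yb: "yb (Suc j) = R (xb (Suc j)) (((1 - t j) / tb (Suc j)) *\<^sub>R \<zeta> j)"
        using step_b[of j] by blast+
      then have "yb (Suc j) \<in> M"
        unfolding yb T_def by (intro A.R_in[OF xb] subspace_scale[OF A.T_subspace[OF xb]])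
      ultimately show ?thesis using z Suc by blast
    qed
  qed
  show ?thesis
  proof (intro allI impI, elim exE conjE)
    fix zs r assume r: "strict_mono r" "(\<lambda>i. z (r i * N)) \<longlonglongrightarrow> zs"
    show "0 \<in> proj_onto (T zs) ` clarke_subdiff F zs"
      unfolding T_def F_def
    proof (rule A.accumulation_point_stationary[OF _ _ r(1), of "\<lambda>i. z (i * N)"])
      show "z (i * N) \<in> M" for i using inM by simp
      \<comment> \<open>\<open>z\<close> at index i N + N is \<open>x\<close> at index i N, so
        consecutive terms are linked by exactly one safeguard comparison.\<close>
      show "f (z (Suc i * N)) + g (z (Suc i * N))
        \<le> f (R (z (i * N)) (A.step (z (i * N)) *\<^sub>R prox_dir M nf g W \<mu> (z (i * N))))
          + g (R (z (i * N)) (A.step (z (i * N)) *\<^sub>R prox_dir M nf g W \<mu> (z (i * N))))" for i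
        using sg(1,2)[of "i * N"] by (simp add: w_def F_def \<eta>_def add.commute)
    qed (rule r(2))
  qed
qed

end
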